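(* Let $T$ be a rooted tree with descent set $V_D$ such that either its root is in $V_D$ or all the children of its root are in $V_D$. Let $h=\deg d(T;n)$ and let $a_0(T),\dots,a_h(T)$ be the coefficients defined by $$ d(T;n)=\sum_{k=0}^{h}a_k(T)\binom{n-h}{k}. $$ Then $a_0(T),a_1(T),\dots,a_h(T)$ is a log-concave sequence of nonnegative integers.
   Context: Rooted trees are finite and nonempty. $T$ has vertex set $V$ of size $s$; $p(v)$ is the parent of a non-root vertex $v$. $T$ comes with a distinguished subset $V_D\subseteq V$, whose elements are called descent vertices; all other vertices are ascent vertices. For an integer $n\ge s$, $G(T;n)$ is the rooted tree with $n$ vertices obtained by adding a chain of $n-s$ vertices above the root of $T$ (if $n>s$, the root of $T$ becomes the child of the bottom vertex of the chain and the top of the chain is the root of $G(T;n)$); the added vertices are ascent vertices. A labeling of a rooted tree with $m$ vertices is a bijection $w$ from its vertices to $[m]=\{1,\dots,m\}$, and $\mathrm{Des}(w)$ is the set of non-root vertices $v$ with $w(v)>w(p(v))$. $D(T;n)$ is the set of labelings $w$ of $G(T;n)$ with $\mathrm{Des}(w)=V_D$, and $d(T;n)=|D(T;n)|$. The function $d(T;n)$ of integers $n\ge s$ agrees with a unique polynomial in $n$, also denoted $d(T;n)$; its degree $h$ is the sum, over the descent vertices $v$ having no proper ancestor in $V_D$, of the number of vertices in the subtree rooted at $v$. The polynomials $\binom{n-h}{0},\binom{n-h}{1},\dots,\binom{n-h}{h}$ in $n$ form a basis of the polynomials of degree at most $h$, so the $a_k(T)$ are uniquely determined. A sequence $(a_k)$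 is log-concave if $a_k^2\ge a_{k-1}a_{k+1}$ for all interior indices $k$. *)

theory Defs
  imports Complex_Main "HOL-Library.FuncSet" "HOL-Computational_Algebra.Polynomial"
begin

(* The value of parent at the root, and outside the vertex set, is irrelevant. *)

record 'a rtree =
  verts :: "'a set"
  tree_root :: 'a
  parent :: "'a \<Rightarrow> 'a"

definition rooted_tree :: "'a rtree \<Rightarrow> bool" where
  "rooted_tree T \<longleftrightarrow>
     finite (verts T) \<and> tree_root T \<in> verts T \<and>
     (\<forall>v \<in> verts T - {tree_root T}. parent T v \<in> verts T) \<and>
     (\<forall>v \<in> verts T. \<exists>k. (parent T ^^ k) v = tree_root T)"

definition children :: "'a rtree \<Rightarrow> 'a \<Rightarrow> 'a set" where
  "children T u = {v \<in> verts T. v \<noteq> tree_root T \<and> parent T v = u}"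

(* G(T;n): the vertices of T are tagged with Inl; the added chain is Inr 0, Inr 1, ...
   from bottom to top. Meaningful for n \<ge> card (verts T). *)

definition chain_above :: "'a rtree \<Rightarrow> nat \<Rightarrow> ('a + nat) rtree" where
  "chain_above T n =
     (let m = n - card (verts T) in
      \<lparr> verts = Inl ` verts T \<union> Inr ` {..<m},
        tree_root = (if m = 0 then Inl (tree_root T) else Inr (m - 1)),
        parent = (\<lambda>x. case x of
                     Inl v \<Rightarrow> (if v = tree_root T then Inr 0 else Inl (parent T v))
                   | Inr i \<Rightarrow> Inr (Suc i)) \<rparr>)"

(* Extensionality makes each bijection on the vertex set count exactly once. *)

definition labelings :: "'a rtree \<Rightarrow> ('a \<Rightarrow> nat) set" where
  "labelings T = {w \<in> extensional (verts T). bij_betw w (verts T) {1..card (verts T)}}"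

definition Des :: "'a rtree \<Rightarrow> ('a \<Rightarrow> nat) \<Rightarrow> 'a set" where
  "Des T w = {v \<in> verts T. v \<noteq> tree_root T \<and> w v > w (parent T v)}"

definition descent_labelings :: "'a rtree \<Rightarrow> 'a set \<Rightarrow> nat \<Rightarrow> ('a + nat \<Rightarrow> nat) set" where
  "descent_labelings T VD n = {w \<in> labelings (chain_above T n). Des (chain_above T n) w = Inl ` VD}"

definition num_descent_labelings :: "'a rtree \<Rightarrow> 'a set \<Rightarrow> nat \<Rightarrow> nat" where
  "num_descent_labelings T VD n = card (descent_labelings T VD n)"

definition descent_poly :: "'a rtree \<Rightarrow> 'a set \<Rightarrow> real poly" where
  "descent_poly T VD =
     (THE P. \<forall>n \<ge> card (verts T). poly P (real n) = real (num_descent_labelings T VD n))"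

definition log_concave :: "nat \<Rightarrow> (nat \<Rightarrow> real) \<Rightarrow> bool" where
  "log_concave h a \<longleftrightarrow> (\<forall>k. 0 < k \<and> k < h \<longrightarrow> (a k)\<^sup>2 \<ge> a (k - 1) * a (k + 1))"

lemma card_verts_chain_above:
  assumes "rooted_tree T" "n \<ge> card (verts T)"
  shows "card (verts (chain_above T n)) = n"
proof -
  have "finite (verts T)" using assms(1) by (simp add: rooted_tree_def)
  then have "card (Inl ` verts T \<union> Inr ` {..<n - card (verts T)} :: ('a + nat) set) = n"
    using assms(2) by (subst card_Un_disjoint) (auto simp: card_image)
  then show ?thesis by (simp add: chain_above_def Let_def)
qed

end

theory Submission
  imports Defs "HOL-Analysis.Product_Vector"
begin

text \<open>
  List the vertices of the extended tree in the order of their labels. A labeling with the given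
  descents is then a linear extension of an oriented tree: an ascent vertex comes before its
  parent, a descent vertex after it. Let the centre be the lowest chain vertex if the root is a
  descent vertex, and the root otherwise; let \<open>A\<close> consist of the centre and the vertices below it, and
  let \<open>H\<close> be the number of the latter. The hypothesis on the root says that every neighbour of the centre in
  \<open>A\<close> comes after the centre. If \<open>R i\<close> is the number of linear extensions of \<open>A\<close> with exactly \<open>i\<close>
  elements before the centre, then the rest of the chain can be shuffled in freely after the centre,
  so that \<open>d(n)\<close> is the sum of \<open>R i * ((n - 1 - i) choose (H - i))\<close> over \<open>i \<le> H\<close>
  (\<open>num_descent_labelings_formula\<close> and \<open>card_linexts_chain_glue\<close>). Vandermonde's identity turns this
  into the Newton expansion whose \<open>k\<close>-th coefficient is the \<open>k\<close>-fold partial sum of \<open>R\<close> at \<open>H\<close>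
  (\<open>newton_value\<close>). These are nonnegative integers. The top one is \<open>R 0\<close>, which is positive because the
  centre can be moved to the front, so the degree is \<open>H\<close>.

  Log-concavity of the coefficients follows from that of \<open>R\<close>, because partial sums preserve
  log-concavity without internal zeros, and three successive partial sums at one place form a
  log-concave triple (\<open>pf2_partial_sum\<close>, \<open>pf2_partial_sum_log_concave\<close>).

  It remains to see that the number of linear extensions of an oriented tree, as a function of the
  position of one vertex, is log-concave (\<open>oriented_tree_rank_count_lc\<close>). Join a tree with vertex \<open>c\<close>
  to a tree with vertex \<open>r\<close> by an edge between \<open>r\<close> and \<open>c\<close>. A linear extension of the join is a shuffle
  of extensions of the two parts, and the constraint of the new edge turns the sequence of the part
  with \<open>c\<close> into its sequence of initial or final sums. The new sequence is therefore a binomially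
  weighted convolution (\<open>rank_count_glue\<close>). That such convolutions preserve log-concavity is
  Liggett's theorem (\<open>pos_lc_merge\<close>). In terms of binary forms it says that a product of two
  bivariate Lorentzian forms is Lorentzian, and the proof is an induction on the degree that shows
  that the second derivatives of the product satisfy the reverse Cauchy-Schwarz inequality
  (\<open>polar_reverse_cs\<close>).
\<close>

section \<open>The polar form of a product of two binary forms\<close>

type_synonym dir = "(real \<times> real) \<times> (real \<times> real)"

text \<open>
  A sequence \<open>P\<close> of length \<open>t + 1\<close> stands for the binary form whose coefficients are
  \<open>(t choose i) * P i\<close>. In this encoding the directional derivative of the form, divided by its
  degree, has the following sequence.
\<close>

definition dseq :: "real \<times> real \<Rightarrow> (nat \<Rightarrow> real) \<Rightarrow> nat \<Rightarrow> real" where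
  "dseq z P = (\<lambda>i. fst z * P (Suc i) + snd z * P i)"

text \<open>
  Let \<open>F\<close> and \<open>G\<close> be the binary forms of degrees \<open>t\<close> and \<open>u\<close> that \<open>P\<close> and \<open>Q\<close> stand for, in
  disjoint pairs of variables. This is the symmetric multilinear form of \<open>F * G\<close>, up to a constant
  factor: the sum over all ways of giving \<open>t\<close> of the directions to \<open>F\<close> and the other \<open>u\<close> to \<open>G\<close>.
  Keeping the variables disjoint is essential: the derivatives of \<open>F * G\<close> along the coordinate axes
  are then again products, whereas with common variables they would be sums of two products.
\<close>

primrec polar :: "dir list \<Rightarrow> nat \<Rightarrow> (nat \<Rightarrow> real) \<Rightarrow> nat \<Rightarrow> (nat \<Rightarrow> real) \<Rightarrow> real" where
  "polar [] t P u Q = (if t = 0 \<and> u = 0 then P 0 * Q 0 else 0)"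
| "polar (z # zs) t P u Q =
     (case t of 0 \<Rightarrow> 0 | Suc t' \<Rightarrow> polar zs t' (dseq (fst z) P) u Q) +
     (case u of 0 \<Rightarrow> 0 | Suc u' \<Rightarrow> polar zs t P u' (dseq (snd z) Q))"

text \<open>
  The diagonal directions identify the two pairs of variables. At these directions the polar form
  yields, up to a constant factor, the sequence that stands for the product of \<open>F\<close> and \<open>G\<close> as one
  binary form.
\<close>

definition dir_x :: dir where "dir_x = ((1, 0), (1, 0))"
definition dir_y :: dir where "dir_y = ((0, 1), (0, 1))"

definition pos_lc :: "nat \<Rightarrow> (nat \<Rightarrow> real) \<Rightarrow> bool" where
  "pos_lc t a \<longleftrightarrow> (\<forall>i\<le>t. 0 < a i) \<and> (\<forall>i. i + 2 \<le> t \<longrightarrow> a i * a (i + 2) \<le> (a (i + 1))\<^sup>2)"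

lemma dseq_lin: "dseq z (\<lambda>i. \<alpha> * P i + \<beta> * P' i) = (\<lambda>i. \<alpha> * dseq z P i + \<beta> * dseq z P' i)"
  by (auto simp: dseq_def algebra_simps)

lemma dseq_lin_dir:
  "dseq (\<alpha> *\<^sub>R z + \<beta> *\<^sub>R z') P = (\<lambda>i. \<alpha> * dseq z P i + \<beta> * dseq z' P i)"
  by (auto simp: dseq_def algebra_simps)

lemma dseq_commute: "dseq z (dseq z' P) = dseq z' (dseq z P)"
  by (auto simp: dseq_def algebra_simps)

lemma dseq_xy [simp]: "dseq (1, 0) P = (\<lambda>i. P (Suc i))" "dseq (0, 1) P = P"
  by (auto simp: dseq_def)

lemma polar_lin1:
  "polar zs t (\<lambda>i. \<alpha> * P i + \<beta> * P' i) u Q = \<alpha> * polar zs t P u Q + \<beta> * polar zs t P' u Q"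
  by (induction zs arbitrary: t P P' u Q)
     (auto simp: dseq_lin algebra_simps split: nat.splits)

lemma polar_lin2:
  "polar zs t P u (\<lambda>i. \<alpha> * Q i + \<beta> * Q' i) = \<alpha> * polar zs t P u Q + \<beta> * polar zs t P u Q'"
  by (induction zs arbitrary: t P u Q Q')
     (auto simp: dseq_lin algebra_simps split: nat.splits)

lemma polar_lin_dir:
  "polar ((\<alpha> *\<^sub>R z + \<beta> *\<^sub>R z') # zs) t P u Q =
     \<alpha> * polar (z # zs) t P u Q + \<beta> * polar (z' # zs) t P u Q"
  by (auto simp: dseq_lin_dir polar_lin1 polar_lin2 algebra_simps split: nat.splits)

lemma polar_swap: "polar (y # z # zs) t P u Q = polar (z # y # zs) t P u Q"
  by (auto simp: dseq_commute split: nat.splits)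

lemma polar_move: "polar (xs @ v # ys) t P u Q = polar (v # xs @ ys) t P u Q"
proof (induction xs arbitrary: t P u Q)
  case (Cons a xs)
  have "polar ((a # xs) @ v # ys) t P u Q = polar (a # v # xs @ ys) t P u Q"
    unfolding append_Cons polar.simps(2)[of a] Cons.IH by simp
  then show ?case
    unfolding append_Cons using polar_swap by metis
qed simp

lemma polar_zero1: "polar zs t (\<lambda>i. 0) u Q = 0"
  using polar_lin1[of zs t 0 "\<lambda>_. 0" 0 "\<lambda>_. 0" u Q] by simp

lemma polar_zero2: "polar zs t P u (\<lambda>i. 0) = 0"
  using polar_lin2[of zs t P u 0 "\<lambda>_. 0" 0 "\<lambda>_. 0"] by simp

lemma pos_lc_dseq:
  assumes "pos_lc (Suc t) P" "v \<in> {dir_x, dir_y}"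
  shows "pos_lc t (dseq (fst v) P)" "pos_lc t (dseq (snd v) P)"
  using assms by (auto simp: pos_lc_def dir_x_def dir_y_def)

lemma polar_pos:
  assumes "pos_lc t P" "pos_lc u Q" "set zs \<subseteq> {dir_x, dir_y}" "length zs = t + u"
  shows "0 < polar zs t P u Q"
  using assms
proof (induction zs arbitrary: t P u Q)
  case Nil
  then show ?case by (auto simp: pos_lc_def)
next
  case (Cons v zs)
  have v: "v \<in> {dir_x, dir_y}" using Cons.prems by auto
  have 1: "0 < polar zs t' (dseq (fst v) P) u Q" if "t = Suc t'" for t'
    using Cons that by (intro Cons.IH) (auto intro: pos_lc_dseq)
  have 2: "0 < polar zs t P u' (dseq (snd v) Q)" if "u = Suc u'" for u'
    using Cons that by (intro Cons.IH) (auto intro: pos_lc_dseq)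
  show ?case
    using 1 2 Cons.prems(4) by (auto split: nat.splits intro: add_pos_pos)
qed

declare polar.simps(2) [simp del]

text \<open>
  A symmetric bilinear form with values \<open>X\<close>, \<open>Y\<close>, \<open>Z\<close> at \<open>(x, x)\<close>, \<open>(x, y)\<close>, \<open>(y, y)\<close> satisfies the
  reverse Cauchy-Schwarz inequality as soon as it is nonpositive at one vector \<open>x - \<tau> y\<close>.
\<close>

lemma reverse_cs_of_neg:
  fixes X Y Z \<tau> :: real
  assumes "X - 2 * \<tau> * Y + \<tau>\<^sup>2 * Z \<le> 0" "0 \<le> Z"
  shows "X * Z \<le> Y\<^sup>2"
proof -
  have "X * Z \<le> (2 * \<tau> * Y - \<tau>\<^sup>2 * Z) * Z"
    using assms by (intro mult_right_mono) auto
  also have "\<dots> = Y\<^sup>2 - (Y - \<tau> * Z)\<^sup>2"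
    by (simp add: power2_eq_square algebra_simps)
  also have "\<dots> \<le> Y\<^sup>2" by simp
  finally show ?thesis .
qed

text \<open>
  This is the central inequality; the proof is of Bochner type. Fix a diagonal direction \<open>v\<close> among
  the remaining ones and let \<open>M a b\<close> be the polar form at \<open>a # b # v # zs\<close>. The direction \<open>v\<close> is the sum
  of \<open>e1\<close>, which acts on the first factor only, and \<open>e2\<close>, which acts on the second one. The derivatives
  of the product along \<open>e1\<close> and \<open>e2\<close> are products of smaller degree, and the induction hypothesis for
  them gives \<open>M a a \<le> (M e1 a)\<^sup>2 / M e1 v + (M e2 a)\<^sup>2 / M e2 v\<close>. It follows that \<open>M\<close> is negative semidefinite
  on the hyperplane \<open>M e1 a = 0\<close>: for such an \<open>a\<close> choose \<open>\<alpha>\<close> so that \<open>b = a + \<alpha> e1\<close> satisfies \<open>M e2 b = 0\<close>;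
  the inequality for \<open>b\<close> reads \<open>M a a + \<alpha>\<^sup>2 M e1 e1 \<le> \<alpha>\<^sup>2 (M e1 e1)\<^sup>2 / M e1 v\<close>, and
  \<open>M e1 v = M e1 e1 + M e1 e2\<close> is at least \<open>M e1 e1\<close>. Since \<open>M e1 y > 0\<close>, subtracting a multiple of \<open>y\<close> from \<open>x\<close>
  leads into this hyperplane.
\<close>

lemma polar_reverse_cs:
  assumes "pos_lc t P" "pos_lc u Q" "set zs \<subseteq> {dir_x, dir_y}" "length zs + 2 = t + u"
    and "y \<in> {dir_x, dir_y}"
  shows "polar (x # x # zs) t P u Q * polar (y # y # zs) t P u Q \<le> (polar (x # y # zs) t P u Q)\<^sup>2"
  using assms
proof (induction zs arbitrary: t P u Q x y)
  case Nil
  consider "t = 2" "u = 0" | "t = 1" "u = 1" | "t = 0" "u = 2" using Nil(4) by fastforce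
  then show ?case
  proof cases
    case 2
    define a b c d where "a = dseq (fst x) P 0" "b = dseq (snd x) Q 0"
      "c = dseq (fst y) P 0" "d = dseq (snd y) Q 0"
    have "(2 * a * b) * (2 * c * d) \<le> (a * d + c * b)\<^sup>2"
      using zero_le_power2[of "a * d - c * b"] by (simp add: power2_eq_square algebra_simps)
    then show ?thesis using 2 by (simp add: polar.simps(2) a_b_c_d_def algebra_simps)
  next
    case 1
    have lc: "P 0 * P 2 \<le> (P 1)\<^sup>2" using Nil(1) 1 unfolding pos_lc_def
      by (metis add_0 le_refl)
    have "0 \<le> ((P 1)\<^sup>2 - P 0 * P 2) * (Q 0)\<^sup>2 * w\<^sup>2" for w using lc by simp
    from this[of "fst (fst x)"] this[of "snd (fst x)"] show ?thesis using 1 Nil(5)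
      by (auto simp: polar.simps(2) numeral_2_eq_2 dir_x_def dir_y_def dseq_def power2_eq_square algebra_simps)
  next
    case 3
    have lc: "Q 0 * Q 2 \<le> (Q 1)\<^sup>2" using Nil(2) 3 unfolding pos_lc_def
      by (metis add_0 le_refl)
    have "0 \<le> ((Q 1)\<^sup>2 - Q 0 * Q 2) * (P 0)\<^sup>2 * w\<^sup>2" for w using lc by simp
    from this[of "fst (snd x)"] this[of "snd (snd x)"] show ?thesis using 3 Nil(5)
      by (auto simp: polar.simps(2) numeral_2_eq_2 dir_x_def dir_y_def dseq_def power2_eq_square algebra_simps)
  qed
next
  case (Cons v zs)
  have v: "v \<in> {dir_x, dir_y}" and zs: "set zs \<subseteq> {dir_x, dir_y}" using Cons.prems by auto
  have vfront: "polar (a # b # v # zs) t P u Q = polar (v # a # b # zs) t P u Q" for a b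
    using polar_move[of "[a, b]" v zs] by simp
  show ?case
  proof (cases t)
    case 0
    then obtain u' where u': "u = Suc u'" using Cons.prems(4) by (cases u) auto
    have "polar (v # a # b # zs) t P u Q = polar (a # b # zs) t P u' (dseq (snd v) Q)" for a b
      using 0 u' by (simp add: polar.simps(2))
    then show ?thesis unfolding vfront
      using Cons.IH[OF Cons.prems(1) pos_lc_dseq(2)[OF _ v] zs _ Cons.prems(5)] Cons.prems 0 u' by simp
  next
    case t': (Suc t')
    show ?thesis
    proof (cases u)
      case 0
      have "polar (v # a # b # zs) t P u Q = polar (a # b # zs) t' (dseq (fst v) P) u Q" for a b
        using 0 t' by (simp add: polar.simps(2))
      then show ?thesis unfolding vfront
        using Cons.IH[OF pos_lc_dseq(1)[OF _ v] Cons.prems(2) zs _ Cons.prems(5)] Cons.prems 0 t' by simp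
    next
      case u': (Suc u')
      define M where "M a b = polar (a # b # v # zs) t P u Q" for a b
      define e1 e2 :: dir where "e1 = (fst v, 0)" and "e2 = (0, snd v)"
      have v_eq: "v = 1 *\<^sub>R e1 + 1 *\<^sub>R e2" by (simp add: e1_def e2_def)
      have z0: "dseq 0 F = (\<lambda>i. 0)" for F by (auto simp: dseq_def)
      have e1f: "polar (e1 # l) t P u Q = polar l t' (dseq (fst v) P) u Q" for l
        by (simp add: polar.simps(2) t' u' e1_def z0 polar_zero2)
      have e2f: "polar (e2 # l) t P u Q = polar l t P u' (dseq (snd v) Q)" for l
        by (simp add: polar.simps(2) t' u' e2_def z0 polar_zero1)
      have M_sym: "M a b = M b a" for a b unfolding M_def by (rule polar_swap)
      have M_lin: "M (\<alpha> *\<^sub>R a + \<beta> *\<^sub>R b) c = \<alpha> * M a c + \<beta> * M b c" for \<alpha> \<beta> a b c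
        unfolding M_def by (rule polar_lin_dir)
      have M_lin2: "M c (\<alpha> *\<^sub>R a + \<beta> *\<^sub>R b) = \<alpha> * M c a + \<beta> * M c b" for \<alpha> \<beta> a b c
        using M_lin M_sym by metis
      have P': "pos_lc t' (dseq (fst v) P)" and Q': "pos_lc u' (dseq (snd v) Q)"
        using Cons.prems t' u' v by (auto intro: pos_lc_dseq)
      have M_v: "M a b = polar (e1 # a # b # zs) t P u Q + polar (e2 # a # b # zs) t P u Q" for a b
        unfolding M_def vfront by (subst v_eq, subst polar_lin_dir) simp
      have M_e: "M e1 a = polar (e1 # a # v # zs) t P u Q" "M e2 a = polar (e2 # a # v # zs) t P u Q" for a
        by (simp_all add: M_def)
      have r1: "0 < M e1 w" if "w \<in> {dir_x, dir_y}" for w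
        unfolding M_e e1f using Cons.prems that P' t' by (intro polar_pos) auto
      have r2: "0 < M e2 w" if "w \<in> {dir_x, dir_y}" for w
        unfolding M_e e2f using Cons.prems that Q' u' by (intro polar_pos) auto
      have m12: "0 < M e1 e2"
      proof -
        have "M e1 e2 = polar (v # zs) t' (dseq (fst v) P) u' (dseq (snd v) Q)"
          unfolding M_e e1f by (simp add: polar.simps(2)[of "(0, snd v)"] e2_def z0 polar_zero1 u' split: nat.splits)
        then show ?thesis using Cons.prems P' Q' t' u' by (auto intro!: polar_pos)
      qed
      have ih1: "polar (e1 # a # a # zs) t P u Q * M e1 v \<le> (M e1 a)\<^sup>2" for a
        unfolding M_e e1f using Cons.prems t' zs
        by (intro Cons.IH P' v) auto
      have ih2: "polar (e2 # a # a # zs) t P u Q * M e2 v \<le> (M e2 a)\<^sup>2" for a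
        unfolding M_e e2f using Cons.prems u' zs
        by (intro Cons.IH Q' v) auto
      have bochner: "M a a \<le> (M e1 a)\<^sup>2 / M e1 v + (M e2 a)\<^sup>2 / M e2 v" for a
        unfolding M_v[of a a] using ih1[of a] ih2[of a] r1[OF v] r2[OF v]
        by (intro add_mono) (simp_all add: pos_le_divide_eq)
      have neg: "M a a \<le> 0" if orth: "M e1 a = 0" for a
      proof -
        define \<alpha> where "\<alpha> = - M e2 a / M e1 e2"
        define b where "b = 1 *\<^sub>R a + \<alpha> *\<^sub>R e1"
        have b1: "M e1 b = \<alpha> * M e1 e1"
          unfolding b_def M_lin2 using orth by simp
        have b2: "M e2 b = 0"
          unfolding b_def M_lin2 \<alpha>_def using m12 M_sym[of e2 e1] by simp
        have bb: "M b b = M a a + \<alpha>\<^sup>2 * M e1 e1"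
        proof -
          have "M b b = 1 * M a b + \<alpha> * M e1 b" by (subst (1) b_def, rule M_lin)
          also have "M a b = M a a"
            unfolding b_def M_lin2 using orth M_sym[of a e1] by simp
          finally show ?thesis by (simp add: b1 power2_eq_square)
        qed
        have v1: "M e1 v = M e1 e1 + M e1 e2"
          by (subst v_eq, subst M_lin2) simp
        have m11: "0 \<le> M e1 e1"
        proof (cases t')
          case 0
          then show ?thesis unfolding M_e e1f
            by (simp add: polar.simps(2)[of "(fst v, 0)"] e1_def z0 polar_zero2 u')
        next
          case (Suc t'')
          then have "M e1 e1 = polar (v # zs) t'' (dseq (fst v) (dseq (fst v) P)) u Q"
            unfolding M_e e1f by (simp add: polar.simps(2)[of "(fst v, 0)"] e1_def z0 polar_zero2 u')
          then show ?thesis using Cons.prems P' t' u' Suc v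
            by (auto intro!: less_imp_le[OF polar_pos] pos_lc_dseq)
        qed
        have "M a a + \<alpha>\<^sup>2 * M e1 e1 \<le> (\<alpha> * M e1 e1)\<^sup>2 / M e1 v"
          using bochner[of b] by (simp add: bb b1 b2)
        also have "\<dots> \<le> \<alpha>\<^sup>2 * M e1 e1"
        proof -
          have "(\<alpha> * M e1 e1)\<^sup>2 = \<alpha>\<^sup>2 * M e1 e1 * M e1 e1" by (simp add: power2_eq_square)
          also have "\<dots> \<le> \<alpha>\<^sup>2 * M e1 e1 * M e1 v" using m11 m12 v1 by (intro mult_left_mono) auto
          finally show ?thesis using r1[OF v] by (simp add: pos_divide_le_eq)
        qed
        finally show ?thesis by simp
      qed
      define \<tau> where "\<tau> = M e1 x / M e1 y"
      define b where "b = 1 *\<^sub>R x + (- \<tau>) *\<^sub>R y"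
      have "M e1 b = 0"
        unfolding b_def M_lin2 using r1[OF Cons.prems(5)] by (simp add: \<tau>_def)
      then have "M b b \<le> 0" by (rule neg)
      moreover have "M b b = M x x - 2 * \<tau> * M x y + \<tau>\<^sup>2 * M y y"
      proof -
        have "M b b = 1 * M x b + (-\<tau>) * M y b" by (subst (1) b_def, rule M_lin)
        moreover have "M x b = M x x - \<tau> * M x y" "M y b = M x y - \<tau> * M y y"
          unfolding b_def M_lin2 using M_sym[of y x] by simp_all
        ultimately show ?thesis by (simp add: power2_eq_square algebra_simps)
      qed
      moreover have "0 \<le> M y y"
        unfolding M_def using Cons.prems by (intro less_imp_le[OF polar_pos]) auto
      ultimately show ?thesis
        using reverse_cs_of_neg[of "M x x" \<tau> "M x y" "M y y"] by (simp add: M_def)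
    qed
  qed
qed

section \<open>Merging preserves log-concavity\<close>

text \<open>
  Two disjoint sequences of \<open>t\<close> and \<open>u\<close> objects are shuffled into one. This counts the shuffles in
  which exactly \<open>i\<close> of the first \<open>j\<close> objects come from the first sequence. The case distinction
  keeps the truncated difference \<open>t - i\<close> from producing a nonzero value for \<open>i > t\<close>.
\<close>

definition merge_count :: "nat \<Rightarrow> nat \<Rightarrow> nat \<Rightarrow> nat \<Rightarrow> nat" where
  "merge_count t u j i = (j choose i) * (if i \<le> t then (t + u - j) choose (t - i) else 0)"

definition merge_seq :: "nat \<Rightarrow> nat \<Rightarrow> (nat \<Rightarrow> real) \<Rightarrow> (nat \<Rightarrow> real) \<Rightarrow> nat \<Rightarrow> real" where
  "merge_seq t u P Q j = (\<Sum>i\<le>j. real (merge_count t u j i) * P i * Q (j - i))"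

text \<open>
  Both sides satisfy Pascal's recursion: the first direction goes either to the first form or to the
  second one.
\<close>

lemma polar_replicate:
  assumes "k + l = t + u"
  shows "polar (replicate k dir_x @ replicate l dir_y) t P u Q = merge_seq t u P Q k"
  using assms
proof (induction k arbitrary: t P u Q)
  case 0
  then have l: "l = t + u" by simp
  have "polar (replicate (t + u) dir_y) t P u Q = real ((t + u) choose t) * P 0 * Q 0"
  proof (induction "t + u" arbitrary: t u)
    case (Suc l)
    show ?case
    proof (cases t)
      case 0
      then obtain u' where "u = Suc u'" using Suc(2) by (cases u) auto
      then show ?thesis using Suc 0 Suc(1)[of 0 u'] by (simp add: polar.simps(2) dir_y_def)
    next
      case t': (Suc t')
      show ?thesis
      proof (cases u)
        case 0
        then show ?thesis using Suc t' Suc(1)[of t' 0] by (simp add: polar.simps(2) dir_y_def)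
      next
        case u': (Suc u')
        show ?thesis using Suc(1)[of t' u] Suc(1)[of t u'] Suc(2) t' u'
          by (simp add: polar.simps(2) dir_y_def algebra_simps)
      qed
    qed
  qed simp
  then show ?case by (simp add: l merge_seq_def merge_count_def)
next
  case (Suc k)
  define W where "W i = (if i \<le> t then l choose (t - i) else 0)" for i
  have tu: "t + u - Suc k = l" using Suc.prems by simp
  have A: "(case t of 0 \<Rightarrow> 0 | Suc t' \<Rightarrow> polar (replicate k dir_x @ replicate l dir_y) t' (dseq (fst dir_x) P) u Q)
     = (\<Sum>i\<le>k. real ((k choose i) * W (Suc i)) * P (Suc i) * Q (k - i))"
  proof (cases t)
    case t': (Suc t')
    have "polar (replicate k dir_x @ replicate l dir_y) t' (dseq (fst dir_x) P) u Q =
        merge_seq t' u (dseq (fst dir_x) P) Q k"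
      using Suc.prems t' by (intro Suc.IH) simp
    also have "\<dots> = (\<Sum>i\<le>k. real ((k choose i) * W (Suc i)) * P (Suc i) * Q (k - i))"
    proof -
      have "t' + u - k = l" using Suc.prems t' by simp
      then show ?thesis unfolding merge_seq_def merge_count_def using t'
        by (intro sum.cong) (auto simp: dir_x_def W_def)
    qed
    finally show ?thesis using t' by simp
  qed (simp add: W_def)
  have B: "(case u of 0 \<Rightarrow> 0 | Suc u' \<Rightarrow> polar (replicate k dir_x @ replicate l dir_y) t P u' (dseq (snd dir_x) Q))
     = (\<Sum>i\<le>k. real ((k choose i) * W i) * P i * Q (Suc k - i))"
  proof (cases u)
    case 0
    have "W i = 0" if "i \<le> k" for i using Suc.prems 0 that by (simp add: W_def)
    then show ?thesis using 0 by simp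
  next
    case u': (Suc u')
    have "polar (replicate k dir_x @ replicate l dir_y) t P u' (dseq (snd dir_x) Q) =
        merge_seq t u' P (dseq (snd dir_x) Q) k"
      using Suc.prems u' by (intro Suc.IH) simp
    also have "\<dots> = (\<Sum>i\<le>k. real ((k choose i) * W i) * P i * Q (Suc k - i))"
    proof -
      have "t + u' - k = l" using Suc.prems u' by simp
      then show ?thesis unfolding merge_seq_def merge_count_def
        by (intro sum.cong) (auto simp: dir_x_def W_def Suc_diff_le)
    qed
    finally show ?thesis using u' by simp
  qed
  have B': "(\<Sum>i\<le>k. real ((k choose i) * W i) * P i * Q (Suc k - i)) =
      real (W 0) * P 0 * Q (Suc k) + (\<Sum>i\<le>k. real ((k choose Suc i) * W (Suc i)) * P (Suc i) * Q (k - i))"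
  proof -
    have "(\<Sum>i\<le>k. real ((k choose i) * W i) * P i * Q (Suc k - i)) =
      (\<Sum>i\<le>Suc k. real ((k choose i) * W i) * P i * Q (Suc k - i))" by simp
    also have "\<dots> = real (W 0) * P 0 * Q (Suc k) +
      (\<Sum>i\<le>k. real ((k choose Suc i) * W (Suc i)) * P (Suc i) * Q (k - i))"
      by (subst sum.atMost_Suc_shift) simp
    finally show ?thesis .
  qed
  have "merge_seq t u P Q (Suc k) = (\<Sum>i\<le>Suc k. real ((Suc k choose i) * W i) * P i * Q (Suc k - i))"
    unfolding merge_seq_def merge_count_def W_def tu ..
  also have "\<dots> = real (W 0) * P 0 * Q (Suc k) +
      (\<Sum>i\<le>k. real (((k choose i) + (k choose Suc i)) * W (Suc i)) * P (Suc i) * Q (k - i))"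
    by (subst sum.atMost_Suc_shift) (simp del: of_nat_mult of_nat_add)
  also have "\<dots> = (\<Sum>i\<le>k. real ((k choose i) * W (Suc i)) * P (Suc i) * Q (k - i)) +
      (\<Sum>i\<le>k. real ((k choose i) * W i) * P i * Q (Suc k - i))"
    unfolding B' by (simp add: sum.distrib algebra_simps)
  finally show ?case
    by (simp only: A B polar.simps(2) replicate.simps append_Cons)
qed

text \<open>
  This is Liggett's theorem on the convolution of ultra-log-concave sequences: consecutive values of
  the merged sequence are the values of the polar form in which one diagonal direction replaces the
  other.
\<close>

lemma pos_lc_merge:
  assumes P: "pos_lc t P" and Q: "pos_lc u Q"
  shows "pos_lc (t + u) (merge_seq t u P Q)"
  unfolding pos_lc_def
proof (intro conjI allI impI)
  fix i assume "i \<le> t + u"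
  then show "0 < merge_seq t u P Q i"
    using polar_pos[OF P Q, of "replicate i dir_x @ replicate (t + u - i) dir_y"]
      polar_replicate[of i "t + u - i" t u P Q] by (auto simp: set_replicate_conv_if)
next
  fix i assume i: "i + 2 \<le> t + u"
  define l where "l = t + u - (i + 2)"
  define zs where "zs = replicate i dir_x @ replicate l dir_y"
  have il: "i + 2 + l = t + u" using i by (simp add: l_def)
  have xx: "polar (dir_x # dir_x # zs) t P u Q = merge_seq t u P Q (i + 2)"
    using polar_replicate[of "i + 2" l t u P Q] il by (simp add: zs_def)
  have xy: "polar (dir_x # dir_y # zs) t P u Q = merge_seq t u P Q (i + 1)"
    using polar_replicate[of "i + 1" "l + 1" t u P Q] il
      polar_move[of "dir_x # replicate i dir_x" dir_y "replicate l dir_y" t P u Q]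
    by (simp add: zs_def polar_swap[of dir_x dir_y])
  have yy: "polar (dir_y # dir_y # zs) t P u Q = merge_seq t u P Q i"
    using polar_replicate[of i "l + 2" t u P Q] il
      polar_move[of "replicate i dir_x" dir_y "dir_y # replicate l dir_y" t P u Q]
      polar_move[of "dir_y # replicate i dir_x" dir_y "replicate l dir_y" t P u Q]
    by (simp add: zs_def)
  have "polar (dir_x # dir_x # zs) t P u Q * polar (dir_y # dir_y # zs) t P u Q
      \<le> (polar (dir_x # dir_y # zs) t P u Q)\<^sup>2"
    using il by (intro polar_reverse_cs P Q) (auto simp: zs_def)
  then show "merge_seq t u P Q i * merge_seq t u P Q (i + 2) \<le> (merge_seq t u P Q (i + 1))\<^sup>2"
    by (simp add: xx xy yy mult.commute)
qed

section \<open>Limits of positive log-concave sequences\<close>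

text \<open>
  Counts of linear extensions may vanish near the ends of their range, where strict positivity
  fails; and plain log-concavity without positivity would admit internal zeros, for which the later
  arguments break down. Pointwise limits of positive log-concave sequences avoid both problems.
\<close>

definition lc_limit :: "nat \<Rightarrow> (nat \<Rightarrow> real) \<Rightarrow> bool" where
  "lc_limit t a \<longleftrightarrow> (\<exists>A. (\<forall>n. pos_lc t (A n)) \<and> (\<forall>i\<le>t. (\<lambda>n. A n i) \<longlonglongrightarrow> a i))"

lemma lc_limit_cong: "lc_limit t a \<Longrightarrow> (\<And>i. i \<le> t \<Longrightarrow> a i = b i) \<Longrightarrow> lc_limit t b"
  unfolding lc_limit_def by metis

lemma lc_limit_merge:
  assumes "lc_limit t P" "lc_limit u Q"
  shows "lc_limit (t + u) (merge_seq t u P Q)"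
proof -
  obtain A where A: "\<And>n. pos_lc t (A n)" "\<And>i. i \<le> t \<Longrightarrow> (\<lambda>n. A n i) \<longlonglongrightarrow> P i"
    using assms(1) unfolding lc_limit_def by auto
  obtain B where B: "\<And>n. pos_lc u (B n)" "\<And>i. i \<le> u \<Longrightarrow> (\<lambda>n. B n i) \<longlonglongrightarrow> Q i"
    using assms(2) unfolding lc_limit_def by auto
  have "(\<lambda>n. merge_seq t u (A n) (B n) j) \<longlonglongrightarrow> merge_seq t u P Q j" if j: "j \<le> t + u" for j
    unfolding merge_seq_def
  proof (intro tendsto_sum)
    fix i assume i: "i \<in> {..j}"
    show "(\<lambda>n. real (merge_count t u j i) * A n i * B n (j - i)) \<longlonglongrightarrow>
        real (merge_count t u j i) * P i * Q (j - i)"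
    proof (cases "i \<le> t \<and> j - i \<le> u")
      case True
      then show ?thesis by (intro tendsto_mult tendsto_const A B) auto
    next
      case False
      then have "merge_count t u j i = 0" using i j by (auto simp: merge_count_def)
      then show ?thesis by simp
    qed
  qed
  then show ?thesis
    unfolding lc_limit_def using pos_lc_merge[OF A(1) B(1)]
    by (intro exI[of _ "\<lambda>n. merge_seq t u (A n) (B n)"]) auto
qed

lemma pos_lc_rev:
  assumes "pos_lc t a"
  shows "pos_lc t (\<lambda>i. a (t - i))"
  unfolding pos_lc_def
proof (intro conjI allI impI)
  fix i assume "i + 2 \<le> t"
  then have "t - i = (t - (i + 2)) + 2" "t - (i + 1) = (t - (i + 2)) + 1" by auto
  then show "a (t - i) * a (t - (i + 2)) \<le> (a (t - (i + 1)))\<^sup>2"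
    using assms unfolding pos_lc_def by (metis diff_le_self le_add_diff_inverse2 mult.commute \<open>i + 2 \<le> t\<close>)
qed (use assms in \<open>auto simp: pos_lc_def\<close>)

lemma lc_limit_rev:
  assumes "lc_limit t a"
  shows "lc_limit t (\<lambda>i. a (t - i))"
proof -
  obtain A where "\<forall>n. pos_lc t (A n)" "\<forall>i\<le>t. (\<lambda>n. A n i) \<longlonglongrightarrow> a i"
    using assms unfolding lc_limit_def by blast
  then show ?thesis
    unfolding lc_limit_def by (intro exI[of _ "\<lambda>n i. A n (t - i)"]) (simp add: pos_lc_rev)
qed

definition partial_sum :: "(nat \<Rightarrow> real) \<Rightarrow> nat \<Rightarrow> real" where
  "partial_sum p n = (\<Sum>i<n. p i)"

text \<open>
  The partial sum of length \<open>0\<close> vanishes, so a small \<open>\<delta>\<close> is added to keep the sequence positive. The result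
  is the sequence of partial sums of \<open>\<delta>, a 0, a 1, ...\<close>, which is log-concave if \<open>\<delta> * a 1 \<le> (a 0)\<^sup>2\<close>.
\<close>

lemma pos_lc_partial_sum:
  assumes a: "pos_lc t a" and \<delta>: "0 < \<delta>" "1 \<le> t \<Longrightarrow> \<delta> * a 1 \<le> (a 0)\<^sup>2"
  shows "pos_lc (Suc t) (\<lambda>k. \<delta> + partial_sum a k)"
proof -
  define p where "p = (\<lambda>k. \<delta> + partial_sum a k)"
  have p_Suc: "p (Suc k) = p k + a k" for k by (simp add: p_def partial_sum_def)
  have pos: "0 < a i" if "i \<le> t" for i using a that by (simp add: pos_lc_def)
  have p_pos: "0 < p k" if "k \<le> Suc t" for k
    using that \<delta> pos unfolding p_def partial_sum_def by (intro add_pos_nonneg sum_nonneg) (auto intro: less_imp_le)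
  have ratio: "p k * a (Suc k) \<le> p (Suc k) * a k" if "Suc k \<le> t" for k
    using that
  proof (induction k)
    case 0
    have "\<delta> * a 1 \<le> (\<delta> + a 0) * a 0" using \<delta> 0 pos[of 0]
      by (simp add: power2_eq_square algebra_simps add_increasing)
    then show ?case by (simp add: p_def partial_sum_def)
  next
    case (Suc k)
    have lc: "a k * a (Suc (Suc k)) \<le> a (Suc k) * a (Suc k)"
      using a Suc.prems unfolding pos_lc_def by (auto simp: power2_eq_square dest!: spec[of _ k])
    have "a k * (p (Suc k) * a (Suc (Suc k))) = p (Suc k) * (a k * a (Suc (Suc k)))" by simp
    also have "\<dots> \<le> p (Suc k) * (a (Suc k) * a (Suc k))"
      using lc p_pos[of "Suc k"] Suc.prems by (intro mult_left_mono) auto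
    also have "\<dots> = a (Suc k) * (p k * a (Suc k) + a k * a (Suc k))" by (simp add: p_Suc algebra_simps)
    also have "\<dots> \<le> a (Suc k) * (p (Suc k) * a k + a k * a (Suc k))"
      using Suc pos[of "Suc k"] by (intro mult_left_mono add_right_mono) auto
    also have "\<dots> = a k * (p (Suc (Suc k)) * a (Suc k))" by (simp add: p_Suc algebra_simps)
    finally show ?case using pos[of k] Suc.prems by (simp only: mult_le_cancel_left_pos)
  qed
  have "p k * p (k + 2) \<le> (p (k + 1))\<^sup>2" if "k + 2 \<le> Suc t" for k
  proof -
    have "p k * p (k + 2) = p k * p (Suc k) + p k * a (Suc k)" by (simp add: p_Suc algebra_simps)
    also have "\<dots> \<le> p k * p (Suc k) + p (Suc k) * a k" using ratio[of k] that by simp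
    also have "\<dots> = (p (k + 1))\<^sup>2" by (simp add: p_Suc algebra_simps power2_eq_square)
    finally show ?thesis .
  qed
  then show ?thesis using p_pos unfolding pos_lc_def p_def by blast
qed

lemma lc_limit_partial_sum:
  assumes "lc_limit t a"
  shows "lc_limit (Suc t) (partial_sum a)"
proof -
  obtain A where A: "\<And>n. pos_lc t (A n)" "\<And>i. i \<le> t \<Longrightarrow> (\<lambda>n. A n i) \<longlonglongrightarrow> a i"
    using assms unfolding lc_limit_def by auto
  (* The approximating sequences vary with n, so the bound on delta has to vary with them. *)
  define \<delta> where "\<delta> n = (if t = 0 then inverse (real (Suc n)) else min (inverse (real (Suc n))) ((A n 0)\<^sup>2 / A n 1))" for n
  have Apos: "0 < A n i" if "i \<le> t" for n i using A(1)[of n] that by (simp add: pos_lc_def)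
  have dpos: "0 < \<delta> n" for n using Apos[of 0 n] Apos[of 1 n] by (simp add: \<delta>_def)
  have dlim: "\<delta> \<longlonglongrightarrow> 0"
  proof (rule tendsto_sandwich[OF _ _ tendsto_const LIMSEQ_inverse_real_of_nat])
    show "\<forall>\<^sub>F n in sequentially. 0 \<le> \<delta> n" by (intro always_eventually allI less_imp_le dpos)
    show "\<forall>\<^sub>F n in sequentially. \<delta> n \<le> inverse (real (Suc n))" by (auto simp: \<delta>_def)
  qed
  have "pos_lc (Suc t) (\<lambda>k. \<delta> n + partial_sum (A n) k)" for n
  proof (intro pos_lc_partial_sum A dpos)
    assume t: "1 \<le> t"
    have "\<delta> n * A n 1 \<le> ((A n 0)\<^sup>2 / A n 1) * A n 1"
      using Apos[of 1 n] t by (intro mult_right_mono) (auto simp: \<delta>_def)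
    then show "\<delta> n * A n 1 \<le> (A n 0)\<^sup>2" using Apos[of 1 n] t by simp
  qed
  moreover have "(\<lambda>n. \<delta> n + partial_sum (A n) k) \<longlonglongrightarrow> 0 + partial_sum a k" if "k \<le> Suc t" for k
    unfolding partial_sum_def using that by (intro tendsto_add dlim tendsto_sum A) auto
  ultimately show ?thesis
    unfolding lc_limit_def by (intro exI[of _ "\<lambda>n k. \<delta> n + partial_sum (A n) k"]) auto
qed

lemma lc_limit_tail_sum:
  assumes "lc_limit t a"
  shows "lc_limit (Suc t) (\<lambda>k. \<Sum>x=k..t. a x)"
proof -
  have lim: "lc_limit (Suc t) (\<lambda>k. partial_sum (\<lambda>i. a (t - i)) (Suc t - k))"
    by (rule lc_limit_rev[OF lc_limit_partial_sum[OF lc_limit_rev[OF assms]]])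
  have eq: "partial_sum (\<lambda>i. a (t - i)) (Suc t - k) = (\<Sum>x=k..t. a x)" if "k \<le> Suc t" for k
    unfolding partial_sum_def
    by (rule sum.reindex_bij_witness[of _ "\<lambda>x. t - x" "\<lambda>x. t - x"])
      (use that in \<open>simp; linarith\<close>)+
  show ?thesis by (rule lc_limit_cong[OF lim eq])
qed

section \<open>Iterated partial sums of log-concave sequences\<close>

text \<open>
  These are the Polya frequency sequences of order two on \<open>{0..H}\<close>: log-concave sequences without
  internal zeros, written in a form that survives limits.
\<close>

definition pf2 :: "nat \<Rightarrow> (nat \<Rightarrow> real) \<Rightarrow> bool" where
  "pf2 H p \<longleftrightarrow> (\<forall>i\<le>H. 0 \<le> p i) \<and>
     (\<forall>i j k. i \<le> j \<longrightarrow> j + k \<le> H \<longrightarrow> p i * p (j + k) \<le> p (i + k) * p j)"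

lemma pf2D: "pf2 H p \<Longrightarrow> i \<le> j \<Longrightarrow> j + k \<le> H \<Longrightarrow> p i * p (j + k) \<le> p (i + k) * p j"
  by (simp add: pf2_def)

lemma pos_lc_imp_pf2:
  assumes "pos_lc H a"
  shows "pf2 H a"
proof -
  have pos: "0 < a i" if "i \<le> H" for i using assms that by (simp add: pos_lc_def)
  have 1: "a i * a (Suc j) \<le> a (Suc i) * a j" if "i \<le> j" "Suc j \<le> H" for i j
    using that
  proof (induction j rule: dec_induct)
    case (step j)
    have lc: "a j * a (Suc (Suc j)) \<le> a (Suc j) * a (Suc j)"
      using assms step.prems unfolding pos_lc_def by (auto simp: power2_eq_square dest!: spec[of _ j])
    have "a j * (a i * a (Suc (Suc j))) = a i * (a j * a (Suc (Suc j)))" by simp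
    also have "\<dots> \<le> a i * (a (Suc j) * a (Suc j))"
      using lc pos[of i] step by (intro mult_left_mono) auto
    also have "\<dots> = a (Suc j) * (a i * a (Suc j))" by simp
    also have "\<dots> \<le> a (Suc j) * (a (Suc i) * a j)"
      using step pos[of "Suc j"] by (intro mult_left_mono) auto
    also have "\<dots> = a j * (a (Suc i) * a (Suc j))" by simp
    finally show ?case using pos[of j] step by (simp only: mult_le_cancel_left_pos)
  qed simp
  have "a i * a (j + k) \<le> a (i + k) * a j" if "i \<le> j" "j + k \<le> H" for i j k
    using that
  proof (induction k)
    case (Suc k)
    have p: "0 < a (i + k) * a (j + k)" using Suc.prems pos by simp
    have "(a (i + k) * a (j + k)) * (a i * a (j + Suc k)) =
        (a i * a (j + k)) * (a (i + k) * a (Suc (j + k)))" by simp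
    also have "\<dots> \<le> (a (i + k) * a j) * (a (Suc (i + k)) * a (j + k))"
      using Suc.prems pos[of "i + k"] pos[of j] pos[of "Suc (j + k)"]
      by (intro mult_mono Suc.IH 1 mult_nonneg_nonneg less_imp_le[OF pos]) auto
    also have "\<dots> = (a (i + k) * a (j + k)) * (a (i + Suc k) * a j)" by simp
    finally show ?case using p by (simp only: mult_le_cancel_left_pos)
  qed simp
  then show ?thesis using less_imp_le[OF pos] by (auto simp: pf2_def)
qed

lemma lc_limit_imp_pf2:
  assumes "lc_limit H a"
  shows "pf2 H a"
proof -
  obtain A where A: "\<And>n. pf2 H (A n)" "\<And>i. i \<le> H \<Longrightarrow> (\<lambda>n. A n i) \<longlonglongrightarrow> a i"
    using assms pos_lc_imp_pf2 unfolding lc_limit_def by blast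
  show ?thesis
    unfolding pf2_def
  proof (intro conjI allI impI)
    fix i assume "i \<le> H"
    then show "0 \<le> a i" using A(1) by (intro LIMSEQ_le_const[OF A(2)]) (auto simp: pf2_def)
  next
    fix i j k assume *: "i \<le> j" "j + k \<le> H"
    show "a i * a (j + k) \<le> a (i + k) * a j"
    proof (rule LIMSEQ_le)
      show "(\<lambda>n. A n i * A n (j + k)) \<longlonglongrightarrow> a i * a (j + k)"
        and "(\<lambda>n. A n (i + k) * A n j) \<longlonglongrightarrow> a (i + k) * a j"
        using * by (auto intro!: tendsto_mult A)
      show "\<exists>N. \<forall>n\<ge>N. A n i * A n (j + k) \<le> A n (i + k) * A n j"
        using A(1) * by (auto simp: pf2_def)
    qed
  qed
qed

text \<open>
  Expand both products into double sums, remove their common part, and compare the remaining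
  terms \<open>p x * p y\<close> and \<open>p (x + (j - i)) * p (y - (j - i))\<close>: the second pair of indices lies closer together.
\<close>

lemma pf2_partial_sum:
  assumes "pf2 H p"
  shows "pf2 H (partial_sum p)"
proof -
  have pos: "0 \<le> p i" if "i \<le> H" for i using assms that by (simp add: pf2_def)
  have "partial_sum p i * partial_sum p (j + k) \<le> partial_sum p (i + k) * partial_sum p j" if "i \<le> j" "j + k \<le> H" for i j k
  proof -
    have split: "partial_sum p (n + k) = partial_sum p n + (\<Sum>y<k. p (n + y))" for n
      by (induction k) (auto simp: partial_sum_def)
    have "partial_sum p i * (\<Sum>y<k. p (j + y)) = (\<Sum>x<i. \<Sum>y<k. p x * p (j + y))"
      unfolding partial_sum_def by (simp add: sum_product)
    also have "\<dots> \<le> (\<Sum>x<i. \<Sum>y<k. p (x + (j - i)) * p (i + y))"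
    proof (intro sum_mono)
      fix x y assume "x \<in> {..<i}" "y \<in> {..<k}"
      then have "p x * p ((i + y) + (j - i)) \<le> p (x + (j - i)) * p (i + y)"
        using that by (intro pf2D[OF assms]) auto
      then show "p x * p (j + y) \<le> p (x + (j - i)) * p (i + y)" using that by (simp add: add.commute)
    qed
    also have "\<dots> = (\<Sum>x\<in>{j-i..<j}. p x) * (\<Sum>y<k. p (i + y))"
    proof -
      have "(\<Sum>x<i. p (x + (j - i))) = (\<Sum>x\<in>{j-i..<j}. p x)"
        by (rule sum.reindex_bij_witness[of _ "\<lambda>x. x - (j - i)" "\<lambda>x. x + (j - i)"])
          (use that in auto)
      then show ?thesis by (simp add: sum_product[symmetric])
    qed
    also have "\<dots> \<le> partial_sum p j * (\<Sum>y<k. p (i + y))"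
      unfolding partial_sum_def using that pos by (intro mult_right_mono sum_mono2 sum_nonneg) auto
    finally show ?thesis by (simp add: split algebra_simps)
  qed
  moreover have "0 \<le> partial_sum p i" if "i \<le> H" for i
    unfolding partial_sum_def using pos that by (intro sum_nonneg) auto
  ultimately show ?thesis by (simp add: pf2_def)
qed

text \<open>
  The same shifting of indices works: \<open>p x * p H \<le> p (x + (H - u)) * p u\<close> for \<open>x < u < H\<close>, and the pairs
  \<open>(x + (H - u), u)\<close> are distinct pairs of numbers below \<open>H\<close>. It compares three consecutive iterates of the
  partial sum at the same place \<open>H\<close>, which will be three consecutive coefficients.
\<close>

lemma pf2_partial_sum_log_concave:
  assumes "pf2 H p"
  shows "p H * partial_sum (partial_sum p) H \<le> (partial_sum p H)\<^sup>2"
proof -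
  have pos: "0 \<le> p i" if "i \<le> H" for i using assms that by (simp add: pf2_def)
  have "p H * partial_sum (partial_sum p) H = (\<Sum>u<H. \<Sum>x<u. p x * p H)"
    unfolding partial_sum_def by (simp add: sum_distrib_left mult.commute)
  also have "\<dots> \<le> (\<Sum>u<H. \<Sum>x<u. p (x + (H - u)) * p u)"
  proof (intro sum_mono)
    fix u x assume "u \<in> {..<H}" "x \<in> {..<u}"
    then have "p x * p (u + (H - u)) \<le> p (x + (H - u)) * p u"
      by (intro pf2D[OF assms]) auto
    then show "p x * p H \<le> p (x + (H - u)) * p u" using \<open>u \<in> {..<H}\<close> by simp
  qed
  also have "\<dots> = (\<Sum>u<H. (\<Sum>x\<in>{H-u..<H}. p x) * p u)"
  proof (intro sum.cong refl)
    fix u assume u: "u \<in> {..<H}"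
    have "(\<Sum>x<u. p (x + (H - u))) = (\<Sum>x\<in>{H-u..<H}. p x)"
      by (rule sum.reindex_bij_witness[of _ "\<lambda>x. x - (H - u)" "\<lambda>x. x + (H - u)"]) (use u in auto)
    then show "(\<Sum>x<u. p (x + (H - u)) * p u) = (\<Sum>x\<in>{H-u..<H}. p x) * p u"
      by (simp add: sum_distrib_right[symmetric])
  qed
  also have "\<dots> \<le> (\<Sum>u<H. partial_sum p H * p u)"
    unfolding partial_sum_def using pos by (intro sum_mono mult_right_mono sum_mono2) auto
  also have "\<dots> = (partial_sum p H)\<^sup>2"
    by (simp add: partial_sum_def sum_distrib_left power2_eq_square)
  finally show ?thesis .
qed

lemma funpow_partial_sum: "(partial_sum ^^ Suc k) p n = (\<Sum>i<n. real ((n - 1 - i) choose k) * p i)"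
proof (induction k arbitrary: n)
  case 0
  then show ?case by (simp add: partial_sum_def)
next
  case (Suc k)
  note IH = Suc.IH
  show ?case
  proof (induction n)
    case 0
    then show ?case by (simp add: partial_sum_def)
  next
    case (Suc n)
    have "(partial_sum ^^ Suc (Suc k)) p (Suc n) = (partial_sum ^^ Suc (Suc k)) p n + (partial_sum ^^ Suc k) p n"
      by (simp add: partial_sum_def)
    also have "\<dots> = (\<Sum>i<n. real ((n - 1 - i) choose Suc k) * p i + real ((n - 1 - i) choose k) * p i)"
      unfolding Suc.IH IH sum.distrib ..
    also have "\<dots> = (\<Sum>i<n. real ((n - i) choose Suc k) * p i)"
    proof (intro sum.cong refl)
      fix i assume "i \<in> {..<n}"
      then have n: "n - i = Suc (n - 1 - i)" by auto
      show "real ((n - 1 - i) choose Suc k) * p i + real ((n - 1 - i) choose k) * p i =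
          real ((n - i) choose Suc k) * p i"
        unfolding n by (simp add: algebra_simps)
    qed
    finally show ?case by simp
  qed
qed

lemma funpow_partial_sum_Nats:
  "(partial_sum ^^ k) (\<lambda>i. real (R i)) n \<in> \<nat>"
proof (induction k arbitrary: n)
  case (Suc k)
  have "partial_sum p n \<in> \<nat>" if "\<And>i. p i \<in> \<nat>" for p n
    unfolding partial_sum_def by (induction n) (auto intro: Nats_add that)
  then show ?case using Suc by simp
qed simp

lemma funpow_partial_sum_log_concave:
  assumes "pf2 H p"
  shows "log_concave H (\<lambda>k. (partial_sum ^^ k) p H)"
proof -
  have "pf2 H ((partial_sum ^^ k) p)" for k
    by (induction k) (auto intro: pf2_partial_sum assms)
  then have "(partial_sum ^^ k) p H * (partial_sum ^^ Suc (Suc k)) p H \<le> ((partial_sum ^^ Suc k) p H)\<^sup>2" for k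
    using pf2_partial_sum_log_concave[of H "(partial_sum ^^ k) p"] by simp
  then show ?thesis
    unfolding log_concave_def
  proof (intro allI impI)
    fix k assume "0 < k \<and> k < H"
    then obtain k' where "k = Suc k'" by (cases k) auto
    then show "(partial_sum ^^ (k - 1)) p H * (partial_sum ^^ (k + 1)) p H \<le> ((partial_sum ^^ k) p H)\<^sup>2"
      using \<open>\<And>k. (partial_sum ^^ k) p H * (partial_sum ^^ Suc (Suc k)) p H \<le> ((partial_sum ^^ Suc k) p H)\<^sup>2\<close>[of k'] by simp
  qed
qed

lemma funpow_partial_sum_top:
  "(partial_sum ^^ H) p H = p 0"
proof (cases H)
  case (Suc h)
  have "(partial_sum ^^ Suc h) p (Suc h) = (\<Sum>i<Suc h. real ((h - i) choose h) * p i)"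
    unfolding funpow_partial_sum by simp
  also have "\<dots> = (\<Sum>i\<in>{0}. real ((h - i) choose h) * p i)"
    by (rule sum.mono_neutral_right) (auto simp: binomial_eq_0)
  finally show ?thesis by (simp add: Suc)
qed simp

section \<open>Linear extensions counted by the position of one element\<close>

text \<open>
  A pair \<open>(a, b)\<close> of \<open>E\<close> demands that \<open>a\<close> comes before \<open>b\<close>. The condition is phrased through forbidden pairs
  because this passes directly to sublists and concatenations.
\<close>

abbreviation obeys :: "('b \<times> 'b) set \<Rightarrow> 'b list \<Rightarrow> bool" where
  "obeys E xs \<equiv> sorted_wrt (\<lambda>x y. (y, x) \<notin> E) xs"

definition linexts :: "'b set \<Rightarrow> ('b \<times> 'b) set \<Rightarrow> 'b list set" where
  "linexts V E = {xs. distinct xs \<and> set xs = V \<and> obeys E xs}"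

definition rank_count :: "'b set \<Rightarrow> ('b \<times> 'b) set \<Rightarrow> 'b \<Rightarrow> nat \<Rightarrow> nat" where
  "rank_count V E r j = card {(L, R). L @ r # R \<in> linexts V E \<and> length L = j}"

definition cut_count :: "'b set \<Rightarrow> ('b \<times> 'b) set \<Rightarrow> 'b set \<Rightarrow> 'b set \<Rightarrow> nat \<Rightarrow> nat" where
  "cut_count V E C D k =
     card {(L, R). L @ R \<in> linexts V E \<and> length L = k \<and> C \<inter> set L = {} \<and> D \<inter> set R = {}}"

lemma finite_linexts: "finite V \<Longrightarrow> finite (linexts V E)"
  by (rule finite_subset[OF _ finite_subset_distinct[of V]]) (auto simp: linexts_def)

lemma length_linexts: "xs \<in> linexts V E \<Longrightarrow> length xs = card V"
  by (auto simp: linexts_def distinct_card)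

lemma obeys_Un: "obeys (E \<union> E') xs \<longleftrightarrow> obeys E xs \<and> obeys E' xs"
  by (induction xs) auto

lemma obeys_filter:
  assumes "E \<subseteq> A \<times> A"
  shows "obeys E (filter (\<lambda>x. x \<in> A) xs) \<longleftrightarrow> obeys E xs"
  using assms by (induction xs) auto

lemma obeys_filter_compl:
  assumes "E \<subseteq> B \<times> B" "A \<inter> B = {}"
  shows "obeys E (filter (\<lambda>x. x \<notin> A) xs) \<longleftrightarrow> obeys E xs"
  using assms by (induction xs) auto

lemma obeys_centre_first:
  assumes "r \<notin> C" "r \<notin> set L" "r \<notin> set R"
  shows "obeys ({r} \<times> C) (L @ r # R) \<longleftrightarrow> C \<inter> set L = {}"
proof -
  have "obeys ({r} \<times> C) xs" if "r \<notin> set xs" for xs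
    using that by (induction xs) auto
  then show ?thesis using assms by (auto simp: sorted_wrt_append)
qed

lemma obeys_centre_last:
  assumes "r \<notin> D" "r \<notin> set L" "r \<notin> set R"
  shows "obeys (D \<times> {r}) (L @ r # R) \<longleftrightarrow> D \<inter> set R = {}"
proof -
  have "obeys (D \<times> {r}) xs" if "r \<notin> set xs" for xs
    using that by (induction xs) auto
  then show ?thesis using assms by (auto simp: sorted_wrt_append)
qed

lemma filter_shuffle_parts:
  assumes "zs \<in> shuffles xs ys" "set xs \<subseteq> A" "set ys \<inter> A = {}"
  shows "filter (\<lambda>x. x \<in> A) zs = xs" "filter (\<lambda>x. x \<notin> A) zs = ys"
proof -
  have 1: "filter (\<lambda>x. x \<in> A) xs = xs" "filter (\<lambda>x. x \<in> A) ys = []"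
    "filter (\<lambda>x. x \<notin> A) xs = []" "filter (\<lambda>x. x \<notin> A) ys = ys"
    using assms by (auto simp: filter_id_conv filter_empty_conv)
  have "filter (\<lambda>x. x \<in> A) zs \<in> {xs}" "filter (\<lambda>x. x \<notin> A) zs \<in> {ys}"
    using imageI[OF assms(1), of "filter (\<lambda>x. x \<in> A)"] imageI[OF assms(1), of "filter (\<lambda>x. x \<notin> A)"]
    by (simp_all add: filter_shuffles 1)
  then show "filter (\<lambda>x. x \<in> A) zs = xs" "filter (\<lambda>x. x \<notin> A) zs = ys" by auto
qed

lemma linexts_glue_iff:
  assumes "A \<inter> B = {}" "r \<in> A" "EA \<subseteq> A \<times> A" "EB \<subseteq> B \<times> B" "C \<subseteq> B" "D \<subseteq> B"
    and E: "E = EA \<union> EB \<union> {r} \<times> C \<union> D \<times> {r}"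
  defines "fA \<equiv> filter (\<lambda>x. x \<in> A)" and "fB \<equiv> filter (\<lambda>x. x \<notin> A)"
  shows "L @ r # R \<in> linexts (A \<union> B) E \<longleftrightarrow>
     fA L @ r # fA R \<in> linexts A EA \<and> fB L @ fB R \<in> linexts B EB \<and>
     C \<inter> set (fB L) = {} \<and> D \<inter> set (fB R) = {}"
proof (cases "distinct (L @ r # R) \<and> set (L @ r # R) = A \<union> B")
  case True
  then have r: "r \<notin> set L" "r \<notin> set R" by auto
  have "obeys EA (L @ r # R) \<longleftrightarrow> obeys EA (fA L @ r # fA R)"
    using obeys_filter[OF assms(3), of "L @ r # R"] assms(2) by (simp add: fA_def)
  moreover have "obeys EB (L @ r # R) \<longleftrightarrow> obeys EB (fB L @ fB R)"
    using obeys_filter_compl[OF assms(4,1), of "L @ r # R"] assms(2) by (simp add: fB_def)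
  moreover have "obeys ({r} \<times> C) (L @ r # R) \<longleftrightarrow> C \<inter> set (fB L) = {}"
    using assms True r by (subst obeys_centre_first) auto
  moreover have "obeys (D \<times> {r}) (L @ r # R) \<longleftrightarrow> D \<inter> set (fB R) = {}"
    using assms True r by (subst obeys_centre_last) auto
  moreover have "distinct (fA L @ r # fA R) \<and> set (fA L @ r # fA R) = A"
    "distinct (fB L @ fB R) \<and> set (fB L @ fB R) = B"
    using True assms(1,2) by (auto simp: fA_def fB_def)
  ultimately show ?thesis using True by (simp only: E linexts_def mem_Collect_eq obeys_Un) blast
next
  case False
  have "distinct (L @ r # R) \<and> set (L @ r # R) = A \<union> B"
    if a: "fA L @ r # fA R \<in> linexts A EA" and b: "fB L @ fB R \<in> linexts B EB"
  proof -
    have d: "distinct xs" if "distinct (fA xs)" "distinct (fB xs)" for xs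
      using that unfolding fA_def fB_def
    proof (induction xs)
      case (Cons x xs)
      then show ?case by (cases "x \<in> A") simp_all
    qed simp
    have "distinct (L @ r # R)"
      by (rule d) (use a b assms(2) in \<open>auto simp: linexts_def fA_def fB_def\<close>)
    moreover have s: "set xs = set (fA xs) \<union> set (fB xs)" for xs by (auto simp: fA_def fB_def)
    have "set (L @ r # R) = A \<union> B"
      using a b by (auto simp: linexts_def s[of L] s[of R])
    ultimately show ?thesis by blast
  qed
  then show ?thesis using False by (auto simp: linexts_def)
qed

text \<open>
  A list in which \<open>r\<close> has \<open>j\<close> predecessors is a shuffle of an \<open>A\<close>-list \<open>LA @ r # RA\<close> with a \<open>B\<close>-list
  \<open>LB @ RB\<close>, where \<open>LA\<close> is shuffled with \<open>LB\<close> and \<open>RA\<close> with \<open>RB\<close>. The constraints between the two sets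
  involve only \<open>r\<close>, hence only the place where the \<open>B\<close>-list is cut.
\<close>

lemma rank_count_glue:
  fixes A B :: "'b set"
  assumes fin: "finite A" "finite B" and disj: "A \<inter> B = {}" and "r \<in> A"
    and "EA \<subseteq> A \<times> A" "EB \<subseteq> B \<times> B" "C \<subseteq> B" "D \<subseteq> B"
    and E: "E = EA \<union> EB \<union> {r} \<times> C \<union> D \<times> {r}"
    and j: "j \<le> card A - 1 + card B"
  shows "rank_count (A \<union> B) E r j =
    (\<Sum>i\<le>j. merge_count (card A - 1) (card B) j i * rank_count A EA r i * cut_count B EB C D (j - i))"
proof -
  define XA where "XA i = {(L, R). L @ r # R \<in> linexts A EA \<and> length L = i}" for i
  define XB where "XB k = {(L, R). L @ R \<in> linexts B EB \<and> length L = k \<and> C \<inter> set L = {} \<and> D \<inter> set R = {}}" for k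
  define I where "I = (SIGMA i:{..j}. XA i \<times> XB (j - i))"
  define f where "f = (\<lambda>(i :: nat, (LA, RA), (LB, RB)). shuffles (LA :: 'b list) LB \<times> shuffles RA (RB :: 'b list))"
  define X where "X = {(L, R). L @ r # R \<in> linexts (A \<union> B) E \<and> length L = j}"
  note glue = linexts_glue_iff[OF disj assms(4-8) E]
  have finXA: "finite (XA i)" for i
    by (rule finite_imageD[OF finite_subset[OF _ finite_linexts[OF fin(1), of EA]],
         of "\<lambda>(L, R). L @ r # R"]) (auto simp: XA_def inj_on_def)
  have finXB: "finite (XB i)" for i
    by (rule finite_imageD[OF finite_subset[OF _ finite_linexts[OF fin(2), of EB]],
         of "\<lambda>(L, R). L @ R"]) (auto simp: XB_def inj_on_def)
  have part: "filter (\<lambda>x. x \<in> A) L = LA" "filter (\<lambda>x. x \<notin> A) L = LB"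
      "filter (\<lambda>x. x \<in> A) R = RA" "filter (\<lambda>x. x \<notin> A) R = RB"
    if "(i, (LA, RA), (LB, RB)) \<in> I" "(L, R) \<in> f (i, (LA, RA), (LB, RB))" for i LA RA LB RB L R
  proof -
    have "set LA \<subseteq> A" "set RA \<subseteq> A" "set LB \<inter> A = {}" "set RB \<inter> A = {}"
      using that(1) disj by (auto simp: I_def XA_def XB_def linexts_def)
    then show "filter (\<lambda>x. x \<in> A) L = LA" "filter (\<lambda>x. x \<notin> A) L = LB"
      "filter (\<lambda>x. x \<in> A) R = RA" "filter (\<lambda>x. x \<notin> A) R = RB"
      using that(2) filter_shuffle_parts[of L LA LB A] filter_shuffle_parts[of R RA RB A]
      by (auto simp: f_def)
  qed
  have "X = (\<Union>p\<in>I. f p)"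
  proof (rule set_eqI, rule iffI)
    fix p assume "p \<in> X"
    then obtain L R where p: "p = (L, R)" and LR: "L @ r # R \<in> linexts (A \<union> B) E" "length L = j"
      by (auto simp: X_def)
    define LA RA LB RB where "LA = filter (\<lambda>x. x \<in> A) L" "RA = filter (\<lambda>x. x \<in> A) R"
      "LB = filter (\<lambda>x. x \<notin> A) L" "RB = filter (\<lambda>x. x \<notin> A) R"
    have "length LA + length LB = j"
      using LR(2) sum_length_filter_compl[of "\<lambda>x. x \<in> A" L] by (simp add: LA_RA_LB_RB_def)
    then have "(length LA, (LA, RA), (LB, RB)) \<in> I"
      using LR(1) unfolding glue by (auto simp: I_def XA_def XB_def LA_RA_LB_RB_def)
    moreover have "p \<in> f (length LA, (LA, RA), (LB, RB))"
      by (simp add: f_def p LA_RA_LB_RB_def partition_in_shuffles)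
    ultimately show "p \<in> (\<Union>p\<in>I. f p)" by blast
  next
    fix p assume "p \<in> (\<Union>p\<in>I. f p)"
    then obtain i LA RA LB RB L R where I: "(i, (LA, RA), (LB, RB)) \<in> I"
      and p: "p = (L, R)" "(L, R) \<in> f (i, (LA, RA), (LB, RB))"
      by (auto simp: f_def)
    have "length L = j" using I p by (auto simp: I_def XA_def XB_def f_def dest: length_shuffles)
    then show "p \<in> X"
      using I unfolding X_def p(1) mem_Collect_eq case_prod_conv glue part[OF I p(2)]
      by (auto simp: I_def XA_def XB_def)
  qed
  then have "card X = (\<Sum>p\<in>I. card (f p))"
  proof (simp only:, intro card_UN_disjoint)
    show "finite I" unfolding I_def using finXA finXB by auto
    show "\<forall>p\<in>I. finite (f p)" by (auto simp: f_def)
    show "\<forall>p\<in>I. \<forall>q\<in>I. p \<noteq> q \<longrightarrow> f p \<inter> f q = {}"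
    proof (intro ballI impI, rule ccontr)
      fix p q assume pq: "p \<in> I" "q \<in> I" "p \<noteq> q" "f p \<inter> f q \<noteq> {}"
      obtain i LA RA LB RB where p: "p = (i, (LA, RA), (LB, RB))" by (metis prod.exhaust)
      obtain i' LA' RA' LB' RB' where q: "q = (i', (LA', RA'), (LB', RB'))" by (metis prod.exhaust)
      obtain L R where LR: "(L, R) \<in> f p" "(L, R) \<in> f q" using pq(4) by fast
      have "LA = LA'" "RA = RA'" "LB = LB'" "RB = RB'"
        using part[OF pq(1)[unfolded p] LR(1)[unfolded p]] part[OF pq(2)[unfolded q] LR(2)[unfolded q]]
        by simp_all
      moreover have "i = length LA" "i' = length LA'" using pq(1,2) by (auto simp: p q I_def XA_def)
      ultimately show False using pq(3) p q by simp
    qed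
  qed
  also have "\<dots> = (\<Sum>p\<in>I. merge_count (card A - 1) (card B) j (fst p))"
  proof (intro sum.cong refl)
    fix p assume pI: "p \<in> I"
    obtain i LA RA LB RB where p: "p = (i, (LA, RA), (LB, RB))" by (metis prod.exhaust)
    have a: "LA @ r # RA \<in> linexts A EA" and i: "length LA = i" "i \<le> j" and b: "LB @ RB \<in> linexts B EB" "length LB = j - i"
      using pI by (auto simp: p I_def XA_def XB_def)
    have lens: "length LA + Suc (length RA) = card A" "length LB + length RB = card B"
      using length_linexts[OF a] length_linexts[OF b(1)] by auto
    have d: "set LA \<inter> set LB = {}" "set RA \<inter> set RB = {}"
      using a b disj by (auto simp: linexts_def)
    have "card (f p) = (j choose i) * ((length RA + length RB) choose (length RA))"
      using i b by (simp add: p f_def card_cartesian_product card_disjoint_shuffles[OF d(1)] card_disjoint_shuffles[OF d(2)])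
    moreover have "length RA = card A - 1 - i" "length RA + length RB = card A - 1 + card B - j"
      using lens i b by auto
    ultimately show "card (f p) = merge_count (card A - 1) (card B) j (fst p)"
      using lens i by (simp add: merge_count_def p)
  qed
  also have "\<dots> = (\<Sum>i\<le>j. \<Sum>q\<in>XA i \<times> XB (j - i). merge_count (card A - 1) (card B) j i)"
    unfolding I_def using finXA finXB by (subst sum.Sigma) (auto simp: case_prod_beta)
  also have "\<dots> = (\<Sum>i\<le>j. merge_count (card A - 1) (card B) j i * card (XA i) * card (XB (j - i)))"
    by (simp add: card_cartesian_product algebra_simps)
  finally show ?thesis by (simp add: rank_count_def cut_count_def X_def XA_def XB_def)
qed

lemma rank_count_eq: "rank_count V E r j = card {xs \<in> linexts V E. j < length xs \<and> xs ! j = r}"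
  unfolding rank_count_def
proof (rule bij_betw_same_card)
  show "bij_betw (\<lambda>(L, R). L @ r # R) {(L, R). L @ r # R \<in> linexts V E \<and> length L = j}
      {xs \<in> linexts V E. j < length xs \<and> xs ! j = r}"
    by (rule bij_betw_byWitness[where f' = "\<lambda>xs. (take j xs, drop (Suc j) xs)"])
      (auto simp: id_take_nth_drop[symmetric])
qed

lemma cut_count_eq:
  "cut_count V E C D k =
    card {xs \<in> linexts V E. k \<le> length xs \<and> C \<inter> set (take k xs) = {} \<and> D \<inter> set (drop k xs) = {}}"
  unfolding cut_count_def
proof (rule bij_betw_same_card)
  show "bij_betw (\<lambda>(L, R). L @ R)
      {(L, R). L @ R \<in> linexts V E \<and> length L = k \<and> C \<inter> set L = {} \<and> D \<inter> set R = {}}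
      {xs \<in> linexts V E. k \<le> length xs \<and> C \<inter> set (take k xs) = {} \<and> D \<inter> set (drop k xs) = {}}"
    by (rule bij_betw_byWitness[where f' = "\<lambda>xs. (take k xs, drop k xs)"]) auto
qed

lemma card_linexts_position:
  assumes "finite V" "finite J" "\<And>j. j \<in> J \<Longrightarrow> j < card V"
  shows "card {xs \<in> linexts V E. \<exists>j\<in>J. xs ! j = r} = (\<Sum>j\<in>J. rank_count V E r j)"
proof -
  have "{xs \<in> linexts V E. \<exists>j\<in>J. xs ! j = r} =
      (\<Union>j\<in>J. {xs \<in> linexts V E. j < length xs \<and> xs ! j = r})"
    using assms(3) by (auto simp: length_linexts)
  also have "card \<dots> = (\<Sum>j\<in>J. rank_count V E r j)"
    unfolding rank_count_eq
  proof (intro card_UN_disjoint ballI impI)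
    fix j j' :: nat assume "j \<noteq> j'"
    then show "{xs \<in> linexts V E. j < length xs \<and> xs ! j = r} \<inter>
        {xs \<in> linexts V E. j' < length xs \<and> xs ! j' = r} = {}"
      by (auto simp: linexts_def nth_eq_iff_index_eq)
  qed (use assms(2) in \<open>auto intro!: finite_subset[OF _ finite_linexts[OF assms(1), of E]]\<close>)
  finally show ?thesis .
qed

lemma cut_count_after:
  assumes "finite V" "c \<in> V" "k \<le> card V"
  shows "cut_count V E {c} {} k = (\<Sum>x=k..card V - 1. rank_count V E c x)"
proof -
  have V: "0 < card V" using assms by (auto simp: card_gt_0_iff)
  have "c \<notin> set (take k xs) \<longleftrightarrow> (\<exists>x\<in>{k..card V - 1}. xs ! x = c)" if "xs \<in> linexts V E" for xs
  proof -
    have xs: "distinct xs" "set xs = V" "length xs = card V"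
      using that by (auto simp: linexts_def distinct_card)
    obtain i where i: "i < card V" "xs ! i = c" using assms(2) xs by (metis in_set_conv_nth)
    have "c \<in> set (take k xs) \<longleftrightarrow> i < k"
      using i xs assms(3) by (auto simp: in_set_conv_nth nth_eq_iff_index_eq)
    moreover have "(\<exists>x\<in>{k..card V - 1}. xs ! x = c) \<longleftrightarrow> k \<le> i"
      using i xs V by (auto simp: nth_eq_iff_index_eq)
    ultimately show ?thesis by auto
  qed
  then have "cut_count V E {c} {} k = card {xs \<in> linexts V E. \<exists>x\<in>{k..card V - 1}. xs ! x = c}"
    unfolding cut_count_eq using assms(3)
    by (intro arg_cong[of _ _ card]) (auto simp: length_linexts)
  then show ?thesis using assms V by (subst (asm) card_linexts_position) auto
qed

lemma cut_count_before:
  assumes "finite V" "c \<in> V" "k \<le> card V"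
  shows "cut_count V E {} {c} k = (\<Sum>x<k. rank_count V E c x)"
proof -
  have "c \<notin> set (drop k xs) \<longleftrightarrow> (\<exists>x\<in>{..<k}. xs ! x = c)" if "xs \<in> linexts V E" for xs
  proof -
    have xs: "distinct xs" "set xs = V" "length xs = card V"
      using that by (auto simp: linexts_def distinct_card)
    have "c \<in> set xs" "set (take k xs) \<inter> set (drop k xs) = {}"
      "set xs = set (take k xs) \<union> set (drop k xs)"
      using assms(2) xs by (simp_all add: set_take_disj_set_drop_if_distinct flip: set_append)
    then have "c \<notin> set (drop k xs) \<longleftrightarrow> c \<in> set (take k xs)" by blast
    also have "\<dots> \<longleftrightarrow> (\<exists>x\<in>{..<k}. xs ! x = c)"
      using xs assms(3) by (auto simp: in_set_conv_nth Bex_def)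
    finally show ?thesis .
  qed
  then have "cut_count V E {} {c} k = card {xs \<in> linexts V E. \<exists>x\<in>{..<k}. xs ! x = c}"
    unfolding cut_count_eq using assms(3)
    by (intro arg_cong[of _ _ card]) (auto simp: length_linexts)
  then show ?thesis using assms by (subst (asm) card_linexts_position) auto
qed

section \<open>Oriented trees\<close>

text \<open>
  Trees on a vertex set, with a centre and with every edge oriented as an order constraint. Each is
  built by joining the centres of two smaller ones; the centre of the first remains the centre.
\<close>

inductive oriented_tree :: "'b set \<Rightarrow> ('b \<times> 'b) set \<Rightarrow> 'b \<Rightarrow> bool" where
  single: "oriented_tree {r} {} r"
| glue_after: "oriented_tree A EA r \<Longrightarrow> oriented_tree B EB c \<Longrightarrow> A \<inter> B = {} \<Longrightarrow>
    oriented_tree (A \<union> B) (EA \<union> EB \<union> {(r, c)}) r"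
| glue_before: "oriented_tree A EA r \<Longrightarrow> oriented_tree B EB c \<Longrightarrow> A \<inter> B = {} \<Longrightarrow>
    oriented_tree (A \<union> B) (EA \<union> EB \<union> {(c, r)}) r"

lemma linexts_append:
  assumes xs: "xs \<in> linexts A EA" and ys: "ys \<in> linexts B EB" and disj: "A \<inter> B = {}"
    and E: "\<And>x y. (x, y) \<in> E \<Longrightarrow> (x, y) \<in> EA \<and> x \<in> A \<and> y \<in> A \<or> (x, y) \<in> EB \<and> x \<in> B \<and> y \<in> B \<or> x \<in> A \<and> y \<in> B"
  shows "xs @ ys \<in> linexts (A \<union> B) E"
proof -
  have "obeys E xs"
    by (rule sorted_wrt_mono_rel[of xs "\<lambda>x y. (y, x) \<notin> EA"])
      (use xs disj E in \<open>auto simp: linexts_def\<close>)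
  moreover have "obeys E ys"
    by (rule sorted_wrt_mono_rel[of ys "\<lambda>x y. (y, x) \<notin> EB"])
      (use ys disj E in \<open>auto simp: linexts_def\<close>)
  moreover have "(y, x) \<notin> E" if "x \<in> A" "y \<in> B" for x y
    using E[of y x] that disj by auto
  ultimately show ?thesis
    using xs ys disj by (auto simp: linexts_def sorted_wrt_append)
qed

lemma oriented_tree_wf:
  assumes "oriented_tree V E r"
  shows "finite V" "r \<in> V" "E \<subseteq> V \<times> V"
proof -
  have "finite V \<and> r \<in> V \<and> E \<subseteq> V \<times> V" using assms by induction auto
  then show "finite V" "r \<in> V" "E \<subseteq> V \<times> V" by auto
qed

lemma oriented_tree_linexts_nonempty:
  assumes "oriented_tree V E r"
  shows "linexts V E \<noteq> {}"
  using assms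
proof induction
  case (single r)
  have "[r] \<in> linexts {r} {}" by (simp add: linexts_def)
  then show ?case by blast
next
  case (glue_after A EA r B EB c)
  obtain xs ys where "xs \<in> linexts A EA" "ys \<in> linexts B EB" using glue_after.IH by blast
  then have "xs @ ys \<in> linexts (A \<union> B) (EA \<union> EB \<union> {(r, c)})"
    using oriented_tree_wf[OF glue_after.hyps(1)] oriented_tree_wf[OF glue_after.hyps(2)] glue_after.hyps(3)
    by (intro linexts_append[of xs A EA ys B EB]) auto
  then show ?case by blast
next
  case (glue_before A EA r B EB c)
  obtain xs ys where "xs \<in> linexts A EA" "ys \<in> linexts B EB" using glue_before.IH by blast
  then have "ys @ xs \<in> linexts (B \<union> A) (EA \<union> EB \<union> {(c, r)})"
    using oriented_tree_wf[OF glue_before.hyps(1)] oriented_tree_wf[OF glue_before.hyps(2)] glue_before.hyps(3)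
    by (intro linexts_append[of ys B EB xs A EA]) auto
  then show ?case unfolding Un_commute[of A B] by blast
qed

lemma oriented_tree_add_leaf:
  assumes "oriented_tree V E r" "x \<in> V" "y \<notin> V" "e = (x, y) \<or> e = (y, x)"
  shows "oriented_tree (insert y V) (insert e E) r"
  using assms(1-3)
proof induction
  case (single r)
  then have "oriented_tree ({r} \<union> {y}) ({} \<union> {} \<union> {e}) r"
    using assms(4) oriented_tree.glue_after[OF oriented_tree.single[of r] oriented_tree.single[of y]]
      oriented_tree.glue_before[OF oriented_tree.single[of r] oriented_tree.single[of y]] by auto
  moreover have "{r} \<union> {y} = insert y {r}" by auto
  ultimately show ?case by simp
next
  case (glue_after A EA r B EB c)
  show ?case
  proof (cases "x \<in> A")
    case True
    have "oriented_tree (insert y A \<union> B) (insert e EA \<union> EB \<union> {(r, c)}) r"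
      using glue_after True by (intro oriented_tree.glue_after) auto
    then show ?thesis by (simp add: insert_commute)
  next
    case False
    have "oriented_tree (A \<union> insert y B) (EA \<union> insert e EB \<union> {(r, c)}) r"
      using glue_after False by (intro oriented_tree.glue_after) auto
    then show ?thesis by (simp add: insert_commute)
  qed
next
  case (glue_before A EA r B EB c)
  show ?case
  proof (cases "x \<in> A")
    case True
    have "oriented_tree (insert y A \<union> B) (insert e EA \<union> EB \<union> {(c, r)}) r"
      using glue_before True by (intro oriented_tree.glue_before) auto
    then show ?thesis by (simp add: insert_commute)
  next
    case False
    have "oriented_tree (A \<union> insert y B) (EA \<union> insert e EB \<union> {(c, r)}) r"
      using glue_before False by (intro oriented_tree.glue_before) auto
    then show ?thesis by (simp add: insert_commute)
  qed
qed

text \<open>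
  By the gluing formula the new sequence is the merge of the two given ones.
\<close>

lemma lc_limit_rank_count_glue:
  assumes fin: "finite A" "finite B" and disj: "A \<inter> B = {}" and r: "r \<in> A"
    and sub: "EA \<subseteq> A \<times> A" "EB \<subseteq> B \<times> B" "C \<subseteq> B" "D \<subseteq> B"
    and E: "E = EA \<union> EB \<union> {r} \<times> C \<union> D \<times> {r}"
    and A: "lc_limit (card A - 1) (\<lambda>j. real (rank_count A EA r j))"
    and B: "lc_limit (card B) (\<lambda>k. real (cut_count B EB C D k))"
  shows "lc_limit (card (A \<union> B) - 1) (\<lambda>j. real (rank_count (A \<union> B) E r j))"
proof -
  have "0 < card A" using fin r by (auto simp: card_gt_0_iff)
  then have c: "card (A \<union> B) - 1 = card A - 1 + card B"
    using fin disj by (simp add: card_Un_disjoint)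
  show ?thesis
    unfolding c
  proof (rule lc_limit_cong[OF lc_limit_merge[OF A B]])
    fix j assume j: "j \<le> card A - 1 + card B"
    show "merge_seq (card A - 1) (card B) (\<lambda>j. real (rank_count A EA r j))
        (\<lambda>k. real (cut_count B EB C D k)) j = real (rank_count (A \<union> B) E r j)"
      unfolding rank_count_glue[OF fin disj r sub E j] merge_seq_def by simp
  qed
qed

text \<open>
  When a tree is joined by the edge between \<open>r\<close> and \<open>c\<close>, the cut counts that enter the gluing formula
  are initial or final sums of the numbers of lists with \<open>c\<close> at a given position. Such sums preserve
  log-concavity, and so does merging.
\<close>

lemma oriented_tree_rank_count_lc:
  assumes "oriented_tree V E r"
  shows "lc_limit (card V - 1) (\<lambda>j. real (rank_count V E r j))"
  using assms
proof induction
  case (single r)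
  have "{(L, R). L @ r # R \<in> linexts {r} {} \<and> length L = 0} = {([], [])}"
  proof -
    have "L = [] \<and> R = []" if "L @ r # R \<in> linexts {r} {}" for L R
      using length_linexts[OF that] by simp
    moreover have "[r] \<in> linexts {r} {}" by (simp add: linexts_def)
    ultimately show ?thesis by auto
  qed
  then have "rank_count {r} {} r 0 = 1" by (simp add: rank_count_def)
  then show ?case
    unfolding lc_limit_def by (intro exI[of _ "\<lambda>_ _. 1"]) (auto simp: pos_lc_def)
next
  case (glue_after A EA r B EB c)
  note A = oriented_tree_wf[OF glue_after.hyps(1)] and B = oriented_tree_wf[OF glue_after.hyps(2)]
  have "0 < card B" using B by (auto simp: card_gt_0_iff)
  then have cB: "Suc (card B - 1) = card B" by simp
  have "lc_limit (card B) (\<lambda>k. real (cut_count B EB {c} {} k))"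
    by (rule lc_limit_cong[OF lc_limit_tail_sum[OF glue_after.IH(2), unfolded cB]])
      (simp add: cut_count_after B)
  from lc_limit_rank_count_glue[OF A(1) B(1) glue_after.hyps(3) A(2,3) B(3) _ _ refl glue_after.IH(1) this]
  show ?case using B by simp
next
  case (glue_before A EA r B EB c)
  note A = oriented_tree_wf[OF glue_before.hyps(1)] and B = oriented_tree_wf[OF glue_before.hyps(2)]
  have "0 < card B" using B by (auto simp: card_gt_0_iff)
  then have cB: "Suc (card B - 1) = card B" by simp
  have "lc_limit (card B) (\<lambda>k. real (cut_count B EB {} {c} k))"
    by (rule lc_limit_cong[OF lc_limit_partial_sum[OF glue_before.IH(2), unfolded cB]])
      (simp add: cut_count_before B partial_sum_def)
  from lc_limit_rank_count_glue[OF A(1) B(1) glue_before.hyps(3) A(2,3) B(3) _ _ refl glue_before.IH(1) this]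
  show ?case using B by simp
qed

text \<open>
  If nothing has to precede \<open>c\<close>, then \<open>c\<close> may be moved to the front of any linear extension.
\<close>

lemma rank_count_first_pos:
  assumes "linexts V E \<noteq> {}" "finite V" "c \<in> V" "\<And>v. (v, c) \<notin> E"
  shows "0 < rank_count V E c 0"
proof -
  obtain xs where xs: "xs \<in> linexts V E" using assms(1) by blast
  then have "c \<in> set xs" using assms(3) by (simp add: linexts_def)
  then obtain L R where "xs = L @ c # R" by (meson split_list)
  then have "c # L @ R \<in> linexts V E"
    using xs assms(4) by (auto simp: linexts_def sorted_wrt_append)
  then have "c # L @ R \<in> {xs \<in> linexts V E. 0 < length xs \<and> xs ! 0 = c}" by simp
  then show ?thesis
    unfolding rank_count_eq using finite_linexts[OF assms(2)] by (subst card_gt_0_iff) auto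
qed

section \<open>Newton expansions of polynomials\<close>

text \<open>
  The \<open>k\<close>-fold partial sum of \<open>R\<close> at \<open>H\<close> has the binomial weights \<open>(H - 1 - i) choose (k - 1)\<close>, and
  Vandermonde's identity evaluates the sum over \<open>k\<close>.
\<close>

lemma newton_value:
  fixes R :: "nat \<Rightarrow> nat"
  assumes "1 \<le> m"
  shows "(\<Sum>k\<le>H. (partial_sum ^^ k) (\<lambda>i. real (R i)) H * real (m choose k)) =
    real (\<Sum>i\<le>H. R i * ((m + H - 1 - i) choose (H - i)))"
proof -
  have vand: "(\<Sum>k<H. (m choose Suc k) * ((H - 1 - i) choose k)) = (m + H - 1 - i) choose (H - i)"
    if "i < H" for i
  proof -
    define q where "q = H - 1 - i"
    have q: "H - i = Suc q" "H = Suc q + i" "m + H - 1 - i = m + q" using that by (auto simp: q_def)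
    have "(m + q) choose Suc q = (\<Sum>k\<le>Suc q. (m choose k) * (q choose (Suc q - k)))"
      by (rule vandermonde[symmetric])
    also have "\<dots> = (\<Sum>k\<le>q. (m choose Suc k) * (q choose (q - k)))"
      by (subst sum.atMost_Suc_shift) simp
    also have "\<dots> = (\<Sum>k\<le>q. (m choose Suc k) * (q choose k))"
      by (intro sum.cong refl) (simp add: binomial_symmetric[symmetric])
    also have "\<dots> = (\<Sum>k<H. (m choose Suc k) * (q choose k))"
      by (rule sum.mono_neutral_left) (auto simp: q(2) binomial_eq_0)
    finally show ?thesis by (simp add: q q_def[symmetric])
  qed
  have "(\<Sum>k\<le>H. (partial_sum ^^ k) (\<lambda>i. real (R i)) H * real (m choose k)) =
      real (R H) + (\<Sum>k<H. (partial_sum ^^ Suc k) (\<lambda>i. real (R i)) H * real (m choose Suc k))"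
    by (subst sum.atMost_shift) simp
  also have "(\<Sum>k<H. (partial_sum ^^ Suc k) (\<lambda>i. real (R i)) H * real (m choose Suc k)) =
      (\<Sum>k<H. \<Sum>i<H. real (R i * ((m choose Suc k) * ((H - 1 - i) choose k))))"
    unfolding funpow_partial_sum by (simp add: sum_distrib_right sum_distrib_left algebra_simps)
  also have "\<dots> = (\<Sum>i<H. \<Sum>k<H. real (R i * ((m choose Suc k) * ((H - 1 - i) choose k))))"
    by (rule sum.swap)
  also have "\<dots> = (\<Sum>i<H. real (R i * (\<Sum>k<H. (m choose Suc k) * ((H - 1 - i) choose k))))"
    by (simp add: sum_distrib_left)
  also have "\<dots> = (\<Sum>i<H. real (R i * ((m + H - 1 - i) choose (H - i))))"
    by (intro sum.cong refl) (simp only: lessThan_iff vand)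
  also have "real (R H) + \<dots> = real (\<Sum>i\<le>H. R i * ((m + H - 1 - i) choose (H - i)))"
    by (simp add: lessThan_Suc_atMost[symmetric])
  finally show ?thesis .
qed

definition newton_poly :: "nat \<Rightarrow> (nat \<Rightarrow> real) \<Rightarrow> real poly" where
  "newton_poly h a = (\<Sum>k\<le>h. smult (a k / fact k) (\<Prod>i<k. [:- real (h + i), 1:]))"

lemma poly_newton_poly: "poly (newton_poly h a) x = (\<Sum>k\<le>h. a k * ((x - real h) gchoose k))"
  by (simp add: newton_poly_def poly_sum poly_prod gbinomial_prod_rev atLeast0LessThan algebra_simps)

lemma degree_newton_poly:
  assumes "a h \<noteq> 0"
  shows "degree (newton_poly h a) = h"
proof -
  define B where "B k = (\<Prod>i<k. [:- real (h + i), 1:])" for k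
  have B: "degree (B k) = k \<and> lead_coeff (B k) = 1" for k
  proof (induction k)
    case (Suc k)
    define L where "L = [:- real (h + k), 1:]"
    have L: "L \<noteq> 0" "degree L = 1" "lead_coeff L = 1" by (simp_all add: L_def)
    have "B k \<noteq> 0" using Suc by auto
    then have "degree (B k * L) = Suc k"
      using Suc L by (subst degree_mult_eq) auto
    moreover have "lead_coeff (B k * L) = 1"
      using conjunct2[OF Suc] L(3) by (simp only: lead_coeff_mult mult_1)
    moreover have "B (Suc k) = B k * L" by (simp add: B_def L_def mult.commute)
    ultimately show ?case by simp
  qed (simp add: B_def)
  have "degree (newton_poly h a) \<le> h"
    unfolding newton_poly_def B_def[symmetric]
    by (intro degree_sum_le) (auto intro!: order_trans[OF degree_smult_le] simp: B)
  moreover have "coeff (newton_poly h a) h = a h / fact h"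
  proof -
    have "coeff (newton_poly h a) h = (\<Sum>k\<le>h. a k / fact k * coeff (B k) h)"
      by (simp add: newton_poly_def B_def coeff_sum)
    also have "\<dots> = (\<Sum>k\<in>{h}. a k / fact k * coeff (B k) h)"
      by (rule sum.mono_neutral_right) (auto intro!: coeff_eq_0 simp: B)
    finally have "coeff (newton_poly h a) h = a h / fact h * coeff (B h) h" by simp
    moreover have "coeff (B h) h = 1" using B[of h] by metis
    ultimately show ?thesis by simp
  qed
  ultimately show ?thesis using assms le_degree[of "newton_poly h a" h] by simp
qed

text \<open>
  At \<open>x = h + k\<close> the terms beyond \<open>k\<close> vanish and the \<open>k\<close>-th binomial coefficient is \<open>1\<close>, so the
  coefficients can be computed one after the other.
\<close>

lemma newton_coeffs_unique:
  assumes "\<And>x::real. (\<Sum>k\<le>h. a k * ((x - real h) gchoose k)) = (\<Sum>k\<le>h. b k * ((x - real h) gchoose k))"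
    and "k \<le> h"
  shows "a k = b k"
  using assms(2)
proof (induction k rule: less_induct)
  case (less k)
  have val: "(\<Sum>j\<le>h. c j * ((real (h + k) - real h) gchoose j)) = (\<Sum>j<k. c j * real (k choose j)) + c k"
    for c :: "nat \<Rightarrow> real"
  proof -
    have "(\<Sum>j\<le>h. c j * ((real (h + k) - real h) gchoose j)) = (\<Sum>j\<le>h. c j * real (k choose j))"
      by (simp add: binomial_gbinomial)
    also have "\<dots> = (\<Sum>j\<le>k. c j * real (k choose j))"
      using less.prems by (intro sum.mono_neutral_right) (auto simp: binomial_eq_0)
    finally show ?thesis by (simp add: lessThan_Suc_atMost[symmetric])
  qed
  have "(\<Sum>j<k. a j * real (k choose j)) = (\<Sum>j<k. b j * real (k choose j))"
    using less by (intro sum.cong) auto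
  then show ?case using assms(1)[of "real (h + k)"] unfolding val by simp
qed

lemma poly_eq_if_agree_eventually:
  fixes P Q :: "real poly"
  assumes "\<And>n. N \<le> n \<Longrightarrow> poly P (real n) = poly Q (real n)"
  shows "P = Q"
proof (rule ccontr)
  assume "P \<noteq> Q"
  then have "finite {x. poly (P - Q) x = 0}" by (intro poly_roots_finite) simp
  moreover have "real ` {N..} \<subseteq> {x. poly (P - Q) x = 0}" using assms by auto
  ultimately have "finite (real ` {N..})" by (rule finite_subset[rotated])
  then show False by (simp add: finite_image_iff inj_on_def infinite_Ici)
qed

section \<open>Labelings as linear extensions\<close>

definition order_edges :: "'b rtree \<Rightarrow> 'b set \<Rightarrow> ('b \<times> 'b) set" where
  "order_edges G D =
     (\<lambda>v. if v \<in> D then (parent G v, v) else (v, parent G v)) ` (verts G - {tree_root G})"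

lemma labeling_iff_linext:
  assumes par: "\<And>v. v \<in> verts G - {tree_root G} \<Longrightarrow> parent G v \<in> verts G \<and> parent G v \<noteq> v"
    and D: "D \<subseteq> verts G - {tree_root G}"
    and xs: "distinct xs" "set xs = verts G"
    and w: "\<And>i. i < length xs \<Longrightarrow> w (xs ! i) = Suc i"
  shows "Des G w = D \<longleftrightarrow> obeys (order_edges G D) xs"
proof -
  have inj: "w a \<noteq> w b" if "a \<in> verts G" "b \<in> verts G" "a \<noteq> b" for a b
    using that w unfolding xs(2)[symmetric] by (metis in_set_conv_nth nat.inject)
  have ob: "obeys E xs \<longleftrightarrow> (\<forall>(a, b)\<in>E. w a < w b)"
    if E: "\<And>a b. (a, b) \<in> E \<Longrightarrow> a \<in> verts G \<and> b \<in> verts G \<and> a \<noteq> b" for E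
  proof
    assume ob: "obeys E xs"
    show "\<forall>(a, b)\<in>E. w a < w b"
    proof safe
      fix a b assume ab: "(a, b) \<in> E"
      then obtain i j where ij: "i < length xs" "xs ! i = a" "j < length xs" "xs ! j = b"
        using E xs by (metis in_set_conv_nth)
      have "\<not> j < i" using ob ab ij by (auto simp: sorted_wrt_iff_nth_less)
      moreover have "i \<noteq> j" using ij E[OF ab] by auto
      ultimately show "w a < w b" using ij w[of i] w[of j] by simp
    qed
  next
    assume "\<forall>(a, b)\<in>E. w a < w b"
    then show "obeys E xs" using w by (fastforce simp: sorted_wrt_iff_nth_less)
  qed
  have "a \<in> verts G \<and> b \<in> verts G \<and> a \<noteq> b" if "(a, b) \<in> order_edges G D" for a b
  proof -
    from that obtain v where "v \<in> verts G - {tree_root G}" "(a, b) = (v, parent G v) \<or> (a, b) = (parent G v, v)"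
      unfolding order_edges_def by (auto split: if_splits)
    then show ?thesis using par[of v] by auto
  qed
  then have "obeys (order_edges G D) xs \<longleftrightarrow> (\<forall>(a, b)\<in>order_edges G D. w a < w b)"
    by (rule ob)
  also have "\<dots> \<longleftrightarrow> (\<forall>v\<in>verts G - {tree_root G}. if v \<in> D then w (parent G v) < w v else w v < w (parent G v))"
    by (auto simp: order_edges_def)
  also have "\<dots> \<longleftrightarrow> (\<forall>v\<in>verts G - {tree_root G}. v \<in> D \<longleftrightarrow> w (parent G v) < w v)"
  proof (intro ball_cong refl)
    fix v assume "v \<in> verts G - {tree_root G}"
    then have "w v \<noteq> w (parent G v)" using inj[of v "parent G v"] par[of v] by auto
    then show "(if v \<in> D then w (parent G v) < w v else w v < w (parent G v)) =
        ((v \<in> D) = (w (parent G v) < w v))" by auto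
  qed
  also have "\<dots> \<longleftrightarrow> Des G w = D"
    using D by (auto simp: Des_def)
  finally show ?thesis ..
qed

text \<open>
  A labeling corresponds to the list of the vertices in the order of their labels.
\<close>

lemma card_labelings_Des:
  assumes fin: "finite (verts G)"
    and par: "\<And>v. v \<in> verts G - {tree_root G} \<Longrightarrow> parent G v \<in> verts G \<and> parent G v \<noteq> v"
    and D: "D \<subseteq> verts G - {tree_root G}"
  shows "card {w \<in> labelings G. Des G w = D} = card (linexts (verts G) (order_edges G D))"
proof -
  define V n where "V = verts G" and "n = card (verts G)"
  define f where "f xs = restrict (\<lambda>v. Suc (inv_into {..<n} ((!) xs) v)) V" for xs
  define g where "g w = map (inv_into V w) [1..<Suc n]" for w :: "'a \<Rightarrow> nat"
  have f: "f xs (xs ! i) = Suc i" if "distinct xs" "set xs = V" "i < n" for xs i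
  proof -
    have len: "length xs = n" using that distinct_card[of xs] by (simp add: n_def V_def)
    have "inj_on ((!) xs) {..<n}" using that len by (auto simp: inj_on_def nth_eq_iff_index_eq)
    then show ?thesis using that len by (auto simp: f_def inv_into_f_f)
  qed
  have g: "distinct (g w)" "set (g w) = V" "length (g w) = n" "\<And>i. i < n \<Longrightarrow> w (g w ! i) = Suc i"
    if w: "bij_betw w V {1..n}" for w
  proof -
    have b: "bij_betw (inv_into V w) {1..n} V" using w by (rule bij_betw_inv_into)
    then have "inj_on (inv_into V w) {1..<Suc n}" "inv_into V w ` {1..<Suc n} = V"
      by (simp_all add: bij_betw_def atLeastLessThanSuc_atLeastAtMost)
    then show "distinct (g w)" "set (g w) = V"
      by (auto simp: g_def distinct_map simp del: upt_Suc)
    show "length (g w) = n" by (simp add: g_def)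
    show "w (g w ! i) = Suc i" if "i < n" for i
    proof -
      have "g w ! i = inv_into V w (Suc i)" using that by (simp add: g_def nth_append del: upt_Suc)
      moreover have "Suc i \<in> w ` V" using w that by (simp add: bij_betw_def)
      ultimately show ?thesis by (simp add: f_inv_into_f)
    qed
  qed
  have len: "length xs = n" if "distinct xs" "set xs = V" for xs
    using that distinct_card[of xs] by (simp add: n_def V_def)
  have "bij_betw g {w \<in> labelings G. Des G w = D} (linexts (verts G) (order_edges G D))"
  proof (rule bij_betw_byWitness[where f' = f])
    show "\<forall>w\<in>{w \<in> labelings G. Des G w = D}. f (g w) = w"
    proof
      fix w assume "w \<in> {w \<in> labelings G. Des G w = D}"
      then have w: "w \<in> extensional V" "bij_betw w V {1..n}"
        by (auto simp: labelings_def V_def n_def)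
      show "f (g w) = w"
      proof (rule extensionalityI[of _ V])
        fix v assume "v \<in> V"
        then obtain i where "i < n" "g w ! i = v" using g[OF w(2)] by (metis in_set_conv_nth)
        then show "f (g w) v = w v" using f[of "g w" i] g[OF w(2)] by auto
      qed (use w in \<open>auto simp: f_def\<close>)
    qed
    have fbij: "bij_betw (f xs) V {1..n}" if xs: "distinct xs" "set xs = V" for xs
    proof -
      have V: "V = (!) xs ` {..<n}" using xs len[OF xs] by (auto simp: set_conv_nth)
      have "f xs ` V = {1..n}"
      proof -
        have "f xs ` V = Suc ` {..<n}" unfolding V image_image
          by (rule image_cong) (auto simp: f[OF xs])
        then show ?thesis by (simp add: lessThan_atLeast0 atLeastLessThanSuc_atLeastAtMost)
      qed
      moreover have "inj_on (f xs) V" unfolding V inj_on_def using f[OF xs] by auto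
      ultimately show ?thesis by (simp add: bij_betw_def)
    qed
    show "\<forall>xs\<in>linexts (verts G) (order_edges G D). g (f xs) = xs"
    proof
      fix xs assume "xs \<in> linexts (verts G) (order_edges G D)"
      then have xs: "distinct xs" "set xs = V" by (auto simp: linexts_def V_def)
      note b = fbij[OF xs]
      show "g (f xs) = xs"
      proof (rule nth_equalityI)
        fix i assume "i < length (g (f xs))"
        then have i: "i < n" by (simp add: g(3)[OF b])
        have "f xs (g (f xs) ! i) = f xs (xs ! i)" using g(4)[OF b i] f[OF xs i] by simp
        moreover have "g (f xs) ! i \<in> V" "xs ! i \<in> V"
          using g(2,3)[OF b] xs len[OF xs] i nth_mem by metis+
        ultimately show "g (f xs) ! i = xs ! i" using b by (auto simp: bij_betw_def inj_on_def)
      qed (simp add: g(3)[OF b] len[OF xs])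
    qed
    show "g ` {w \<in> labelings G. Des G w = D} \<subseteq> linexts (verts G) (order_edges G D)"
    proof safe
      fix w assume w: "w \<in> labelings G" "D = Des G w"
      then have b: "bij_betw w V {1..n}" by (auto simp: labelings_def V_def n_def)
      show "g w \<in> linexts (verts G) (order_edges G (Des G w))"
        using labeling_iff_linext[OF par D, of "g w" w] g[OF b] w by (simp add: linexts_def V_def)
    qed
    show "f ` linexts (verts G) (order_edges G D) \<subseteq> {w \<in> labelings G. Des G w = D}"
    proof safe
      fix xs assume "xs \<in> linexts (verts G) (order_edges G D)"
      then have xs: "distinct xs" "set xs = V" "obeys (order_edges G D) xs"
        by (auto simp: linexts_def V_def)
      show "f xs \<in> labelings G"
        using fbij[OF xs(1,2)] by (auto simp: labelings_def V_def n_def f_def)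
      have "Des G (f xs) = D"
        using labeling_iff_linext[OF par D, of xs "f xs"] xs len[OF xs(1,2)] f[OF xs(1,2)]
        by (simp add: V_def)
      then show "x \<in> Des G (f xs) \<Longrightarrow> x \<in> D" "x \<in> D \<Longrightarrow> x \<in> Des G (f xs)" for x by auto
    qed
  qed
  then show ?thesis by (rule bij_betw_same_card)
qed

section \<open>A chain attached to the centre\<close>

definition chain_edges :: "nat \<Rightarrow> nat \<Rightarrow> (('a + nat) \<times> ('a + nat)) set" where
  "chain_edges lo m = {(Inr i, Inr (Suc i)) | i. lo \<le> i \<and> Suc i < m}"

lemma linexts_chain:
  "linexts (Inr ` {lo..<m} :: ('a + nat) set) (chain_edges lo m) = {map Inr [lo..<m]}"
proof (induction "m - lo" arbitrary: lo)
  case 0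
  then show ?case by (auto simp: linexts_def)
next
  case (Suc l)
  then have lo: "lo < m" by simp
  have B: "(Inr ` {lo..<m} :: ('a + nat) set) = insert (Inr lo) (Inr ` {Suc lo..<m})"
    using lo by (auto simp: atLeastLessThan_eq_atLeastAtMost_diff) 
  have IH: "linexts (Inr ` {Suc lo..<m} :: ('a + nat) set) (chain_edges (Suc lo) m) = {map Inr [Suc lo..<m]}"
    using Suc by simp
  have "xs = map Inr [lo..<m]" if xs: "xs \<in> linexts (Inr ` {lo..<m}) (chain_edges lo m)" for xs :: "('a + nat) list"
  proof -
    have s: "distinct xs" "set xs = Inr ` {lo..<m}" "obeys (chain_edges lo m) xs"
      using xs by (auto simp: linexts_def)
    obtain x ys where x: "xs = x # ys" using s(2) lo by (cases xs) auto
    have "x \<in> Inr ` {lo..<m}" using s(2) x by (metis list.set_intros(1))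
    then obtain i where i: "x = Inr i" "lo \<le> i" "i < m" by auto
    have "i = lo"
    proof (rule ccontr)
      assume "i \<noteq> lo"
      then obtain i' where i': "i = Suc i'" "lo \<le> i'" using i by (cases i) auto
      have "Inr i' \<in> set xs" using s(2) i i' by auto
      then have "Inr i' \<in> set ys" using x i i' by auto
      then have "(Inr i', x) \<notin> chain_edges lo m" using s(3) x by auto
      moreover have "(Inr i', x) \<in> chain_edges lo m" using i i' by (simp add: chain_edges_def)
      ultimately show False by blast
    qed
    moreover have "ys \<in> linexts (Inr ` {Suc lo..<m}) (chain_edges (Suc lo) m)"
    proof -
      have "set ys = Inr ` {Suc lo..<m}"
      proof -
        have "set ys = set xs - {x}" using s(1) x by auto
        also have "\<dots> = Inr ` {Suc lo..<m}" unfolding s(2) B using i \<open>i = lo\<close> by auto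
        finally show ?thesis .
      qed
      moreover have "obeys (chain_edges (Suc lo) m) ys"
        by (rule sorted_wrt_mono_rel[of ys "\<lambda>x y. (y, x) \<notin> chain_edges lo m"])
          (use s(3) x in \<open>auto simp: chain_edges_def\<close>)
      ultimately show ?thesis using s(1) x by (simp add: linexts_def)
    qed
    ultimately show ?thesis using IH x i lo by (simp add: upt_conv_Cons)
  qed
  moreover have "map Inr [lo..<m] \<in> linexts (Inr ` {lo..<m} :: ('a + nat) set) (chain_edges lo m)"
    by (auto simp: linexts_def distinct_map sorted_wrt_map chain_edges_def sorted_wrt_iff_nth_less)
  ultimately show ?case by blast
qed

lemma cut_count_chain:
  "cut_count (Inr ` {lo..<m} :: ('a + nat) set) (chain_edges lo m) (Inr ` {lo..<m} \<inter> {Inr lo}) {} k =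
    (if k = 0 then 1 else 0)"
proof -
  have "{(L, R). L @ R \<in> linexts (Inr ` {lo..<m} :: ('a + nat) set) (chain_edges lo m) \<and> length L = k
      \<and> Inr ` {lo..<m} \<inter> {Inr lo} \<inter> set L = {} \<and> {} \<inter> set R = {}} =
    (if k = 0 then {([], map Inr [lo..<m])} else {})"
  proof -
    have "k = 0" if LR: "L @ R = (map Inr [lo..<m] :: ('a + nat) list)" "length L = k"
      "Inr ` {lo..<m} \<inter> {Inr lo} \<inter> set L = {}" for L R
    proof (rule ccontr)
      assume "k \<noteq> 0"
      then obtain x L' where L: "L = x # L'" using LR(2) by (cases L) auto
      then have "lo < m" using LR(1) by (cases "lo < m") auto
      then have "x = Inr lo" using LR(1) L by (simp add: upt_conv_Cons)
      then show False using LR(3) L \<open>lo < m\<close> by auto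
    qed
    then show ?thesis unfolding linexts_chain by auto
  qed
  then show ?thesis by (simp add: cut_count_def)
qed

text \<open>
  The chain has a single linear extension and starts with the neighbour of \<open>c\<close>. Hence all of it comes
  after \<open>c\<close>, and only one term of the gluing formula survives: an extension of \<open>A\<close> with \<open>i\<close> elements
  before \<open>c\<close> admits all shuffles of the chain with the \<open>H - i\<close> elements after \<open>c\<close>.
\<close>

lemma card_linexts_chain_glue:
  fixes A :: "('a + nat) set"
  assumes fin: "finite A" and disj: "A \<inter> Inr ` {lo..<m} = {}" and c: "c \<in> A" and EA: "EA \<subseteq> A \<times> A"
    and E: "E = EA \<union> chain_edges lo m \<union> {c} \<times> (Inr ` {lo..<m} \<inter> {Inr lo})"
    and H: "card A = Suc H"
  shows "card (linexts (A \<union> Inr ` {lo..<m}) E) =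
    (\<Sum>i\<le>H. rank_count A EA c i * ((H + (m - lo) - i) choose (H - i)))"
proof -
  define B :: "('a + nat) set" where "B = Inr ` {lo..<m}"
  have B: "finite B" "card B = m - lo" by (auto simp: B_def card_image)
  have V: "card (A \<union> B) = Suc (H + (m - lo))"
    using fin B disj H by (simp add: card_Un_disjoint B_def)
  have EB: "chain_edges lo m \<subseteq> B \<times> B" by (auto simp: chain_edges_def B_def)
  have E': "E = EA \<union> chain_edges lo m \<union> {c} \<times> (B \<inter> {Inr lo}) \<union> {} \<times> {c}"
    by (simp add: E B_def)
  have rc: "rank_count (A \<union> B) E c j =
      (if j \<le> H then rank_count A EA c j * ((H + (m - lo) - j) choose (H - j)) else 0)"
    if j: "j \<le> H + (m - lo)" for j
  proof -
    have "rank_count (A \<union> B) E c j = (\<Sum>i\<le>j. merge_count (card A - 1) (card B) j i *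
        rank_count A EA c i * cut_count B (chain_edges lo m) (B \<inter> {Inr lo}) {} (j - i))"
      using j H B by (intro rank_count_glue fin B disj[folded B_def] c EA EB E') auto
    also have "\<dots> = (\<Sum>i\<le>j. merge_count H (m - lo) j i * rank_count A EA c i * (if j - i = 0 then 1 else 0))"
      unfolding B_def cut_count_chain using H B by (simp add: B_def)
    also have "\<dots> = (\<Sum>i\<in>{j}. merge_count H (m - lo) j i * rank_count A EA c i * (if j - i = 0 then 1 else 0))"
      by (rule sum.mono_neutral_right) auto
    finally show ?thesis by (simp add: merge_count_def)
  qed
  have "linexts (A \<union> B) E = {xs \<in> linexts (A \<union> B) E. \<exists>j\<in>{..H + (m - lo)}. xs ! j = c}"
  proof -
    have "\<exists>j\<in>{..H + (m - lo)}. xs ! j = c" if xs: "xs \<in> linexts (A \<union> B) E" for xs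
    proof -
      have "c \<in> set xs" using xs c by (simp add: linexts_def)
      then obtain j where "j < length xs" "xs ! j = c" by (metis in_set_conv_nth)
      then show ?thesis using length_linexts[OF xs] V by auto
    qed
    then show ?thesis by auto
  qed
  then have "card (linexts (A \<union> B) E) = card {xs \<in> linexts (A \<union> B) E. \<exists>j\<in>{..H + (m - lo)}. xs ! j = c}"
    by simp
  also have "\<dots> = (\<Sum>j\<le>H + (m - lo). rank_count (A \<union> B) E c j)"
    using fin B V by (intro card_linexts_position) auto
  also have "\<dots> = (\<Sum>j\<le>H + (m - lo). if j \<le> H then rank_count A EA c j * ((H + (m - lo) - j) choose (H - j)) else 0)"
    by (intro sum.cong refl) (simp add: rc)
  also have "\<dots> = (\<Sum>j\<le>H. rank_count A EA c j * ((H + (m - lo) - j) choose (H - j)))"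
    by (rule sum.mono_neutral_cong_right) auto
  finally show ?thesis by (simp add: B_def)
qed

section \<open>Rooted trees as oriented trees\<close>

definition tree_depth :: "'a rtree \<Rightarrow> 'a \<Rightarrow> nat" where
  "tree_depth T v = (LEAST k. (parent T ^^ k) v = tree_root T)"

lemma tree_depth_parent:
  assumes "rooted_tree T" "v \<in> verts T" "v \<noteq> tree_root T"
  shows "tree_depth T v = Suc (tree_depth T (parent T v))"
proof -
  obtain k where "(parent T ^^ k) v = tree_root T" using assms unfolding rooted_tree_def by blast
  then show ?thesis
    unfolding tree_depth_def using assms(3)
    by (subst Least_Suc[of _ k]) (auto simp: funpow_swap1)
qed

definition tree_edges :: "'a rtree \<Rightarrow> 'a set \<Rightarrow> 'a set \<Rightarrow> (('a + nat) \<times> ('a + nat)) set" where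
  "tree_edges T VD S =
     (\<lambda>v. if v \<in> VD then (Inl (parent T v), Inl v) else (Inl v, Inl (parent T v))) `
       (S - {tree_root T})"

text \<open>
  A vertex of maximal depth in \<open>S\<close> is a leaf and can be added last. The part \<open>A0\<close> is either empty or the
  bottom vertex of the chain, which then serves as the centre \<open>c\<close> in place of the root.
\<close>

lemma oriented_tree_grow:
  assumes T: "rooted_tree T" and base: "oriented_tree (A0 \<union> {Inl (tree_root T)}) E0 c"
    and A0: "A0 \<inter> Inl ` verts T = {}"
    and S: "S \<subseteq> verts T" "tree_root T \<in> S" "\<And>v. v \<in> S - {tree_root T} \<Longrightarrow> parent T v \<in> S"
  shows "oriented_tree (A0 \<union> Inl ` S) (E0 \<union> tree_edges T VD S) c"
  using S
proof (induction "card S" arbitrary: S)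
  case 0
  then have "S = {}" using finite_subset[OF 0(2)] T by (auto simp: rooted_tree_def)
  then show ?case using 0 by simp
next
  case (Suc n)
  have fin: "finite S" using finite_subset[OF Suc(3)] T by (auto simp: rooted_tree_def)
  show ?case
  proof (cases "S = {tree_root T}")
    case True
    then show ?thesis using base by (simp add: tree_edges_def)
  next
    case False
    have ne: "S - {tree_root T} \<noteq> {}" "finite (S - {tree_root T})" using False Suc(4) fin by auto
    have "Max (tree_depth T ` (S - {tree_root T})) \<in> tree_depth T ` (S - {tree_root T})"
      using ne by (intro Max_in) auto
    then obtain v where v: "v \<in> S - {tree_root T}" "tree_depth T v = Max (tree_depth T ` (S - {tree_root T}))"
      by (metis (no_types, lifting) imageE)
    have leaf: "parent T u \<noteq> v" if u: "u \<in> S - {tree_root T}" for u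
    proof
      assume "parent T u = v"
      then have "tree_depth T u = Suc (tree_depth T v)"
        using tree_depth_parent[OF T, of u] u Suc(3) by auto
      moreover have "tree_depth T u \<le> tree_depth T v"
        unfolding v(2) using u ne by (intro Max_ge) auto
      ultimately show False by simp
    qed
    define S' where "S' = S - {v}"
    have S': "S = insert v S'" "v \<notin> S'" using v by (auto simp: S'_def)
    have "oriented_tree (A0 \<union> Inl ` S') (E0 \<union> tree_edges T VD S') c"
    proof (rule Suc(1))
      show "n = card S'" using Suc(2) fin v by (simp add: S'_def)
      show "parent T u \<in> S'" if "u \<in> S' - {tree_root T}" for u
        using Suc(5)[of u] leaf[of u] that by (auto simp: S'_def)
    qed (use Suc v in \<open>auto simp: S'_def\<close>)
    moreover define e :: "('a + nat) \<times> ('a + nat)" where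
      "e = (if v \<in> VD then (Inl (parent T v), Inl v) else (Inl v, Inl (parent T v)))"
    ultimately have "oriented_tree (insert (Inl v) (A0 \<union> Inl ` S')) (insert e (E0 \<union> tree_edges T VD S')) c"
      using Suc(3,5) v leaf[of v] A0 S'(2)
      by (intro oriented_tree_add_leaf[where x = "Inl (parent T v)"]) (auto simp: S'_def)
    moreover have "insert (Inl v) (A0 \<union> Inl ` S') = A0 \<union> Inl ` S" using S' by auto
    moreover have "tree_edges T VD S = insert e (tree_edges T VD S')"
    proof -
      have "S - {tree_root T} = insert v (S' - {tree_root T})" using v S'(1) by auto
      then show ?thesis by (simp add: tree_edges_def e_def)
    qed
    ultimately show ?thesis by simp
  qed
qed

section \<open>Counting the labelings of the extended tree\<close>

lemma rooted_tree_parent: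
  assumes "rooted_tree T" "v \<in> verts T" "v \<noteq> tree_root T"
  shows "parent T v \<in> verts T" "parent T v \<noteq> v"
proof -
  show "parent T v \<in> verts T" using assms by (auto simp: rooted_tree_def)
  show "parent T v \<noteq> v"
  proof
    assume "parent T v = v"
    then have "(parent T ^^ k) v = v" for k by (induction k) auto
    then show False using assms unfolding rooted_tree_def by metis
  qed
qed

lemma chain_above_parent:
  assumes T: "rooted_tree T" and v: "v \<in> verts (chain_above T n)" "v \<noteq> tree_root (chain_above T n)"
  shows "parent (chain_above T n) v \<in> verts (chain_above T n) \<and> parent (chain_above T n) v \<noteq> v"
proof (cases v)
  case (Inl u)
  then show ?thesis
    using v rooted_tree_parent[OF T, of u] by (auto simp: chain_above_def Let_def split: if_splits)
next
  case (Inr i)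
  then show ?thesis using v by (auto simp: chain_above_def Let_def split: if_splits)
qed

lemma num_descent_labelings_linexts:
  assumes T: "rooted_tree T" and VD: "Inl ` VD \<subseteq> verts (chain_above T n) - {tree_root (chain_above T n)}"
  shows "num_descent_labelings T VD n =
    card (linexts (verts (chain_above T n)) (order_edges (chain_above T n) (Inl ` VD)))"
proof -
  have "finite (verts (chain_above T n))"
    using T by (auto simp: chain_above_def Let_def rooted_tree_def)
  then show ?thesis
    unfolding num_descent_labelings_def descent_labelings_def
    using chain_above_parent[OF T] VD by (intro card_labelings_Des) auto
qed

lemma order_edges_chain_above:
  assumes "tree_root T \<in> verts T" "card (verts T) < n"
  shows "order_edges (chain_above T n) (Inl ` VD) =
    tree_edges T VD (verts T) \<union>
    {if tree_root T \<in> VD then (Inr 0, Inl (tree_root T)) else (Inl (tree_root T), Inr 0)} \<union>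
    chain_edges 0 (n - card (verts T))"
proof -
  define m where "m = n - card (verts T)"
  have m: "0 < m" using assms(2) by (simp add: m_def)
  define e where "e = (\<lambda>v. if v \<in> Inl ` VD then (parent (chain_above T n) v, v)
    else (v, parent (chain_above T n) v))"
  have "verts (chain_above T n) - {tree_root (chain_above T n)} =
      Inl ` (verts T - {tree_root T}) \<union> {Inl (tree_root T)} \<union> Inr ` {..<m - 1}"
    using m assms(1) by (auto simp: chain_above_def Let_def m_def[symmetric])
  then have "order_edges (chain_above T n) (Inl ` VD) =
      e ` Inl ` (verts T - {tree_root T}) \<union> {e (Inl (tree_root T))} \<union> e ` Inr ` {..<m - 1}"
    by (simp only: order_edges_def e_def[symmetric] image_Un image_insert image_empty)
  moreover have "e ` Inl ` (verts T - {tree_root T}) = tree_edges T VD (verts T)"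
    unfolding tree_edges_def image_image
    by (rule image_cong) (auto simp: e_def chain_above_def Let_def)
  moreover have "e (Inl (tree_root T)) =
      (if tree_root T \<in> VD then (Inr 0, Inl (tree_root T)) else (Inl (tree_root T), Inr 0))"
    by (auto simp: e_def chain_above_def Let_def)
  moreover have "e ` Inr ` {..<m - 1} = chain_edges 0 m"
  proof -
    have "e ` Inr ` {..<m - 1} = (\<lambda>i. (Inr i, Inr (Suc i))) ` {..<m - 1}"
      unfolding image_image by (rule image_cong) (auto simp: e_def chain_above_def Let_def)
    also have "\<dots> = chain_edges 0 m" using m by (auto simp: chain_edges_def)
    finally show ?thesis .
  qed
  ultimately show ?thesis by (simp add: m_def)
qed

lemma order_edges_root_ascent:
  assumes "tree_root T \<in> verts T" "tree_root T \<notin> VD" "card (verts T) \<le> n"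
  shows "order_edges (chain_above T n) (Inl ` VD) =
    tree_edges T VD (verts T) \<union> chain_edges 0 (n - card (verts T)) \<union>
    {Inl (tree_root T)} \<times> (Inr ` {0..<n - card (verts T)} \<inter> {Inr 0})"
proof (cases "n = card (verts T)")
  case True
  have "order_edges (chain_above T n) (Inl ` VD) = tree_edges T VD (verts T)"
    unfolding tree_edges_def order_edges_def
    using True by (auto simp: chain_above_def image_iff)
  then show ?thesis using True by (simp add: chain_edges_def)
next
  case False
  then have "Inr ` {0..<n - card (verts T)} \<inter> {Inr 0} = {Inr 0 :: 'a + nat}" using assms(3) by auto
  then show ?thesis using order_edges_chain_above[of T n VD] assms False by auto
qed

lemma order_edges_root_descent:
  assumes "tree_root T \<in> verts T" "tree_root T \<in> VD" "card (verts T) < n"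
  shows "order_edges (chain_above T n) (Inl ` VD) =
    tree_edges T VD (verts T) \<union> {(Inr 0, Inl (tree_root T))} \<union> chain_edges 1 (n - card (verts T)) \<union>
    {Inr 0} \<times> (Inr ` {1..<n - card (verts T)} \<inter> {Inr 1})"
proof -
  have "chain_edges 0 m = chain_edges 1 m \<union> {Inr 0} \<times> (Inr ` {1..<m} \<inter> {Inr 1 :: 'a + nat})" for m
    unfolding chain_edges_def
  proof (intro equalityI subsetI)
    fix p :: "('a + nat) \<times> ('a + nat)"
    assume "p \<in> {(Inr i, Inr (Suc i)) | i. 0 \<le> i \<and> Suc i < m}"
    then obtain i where "p = (Inr i, Inr (Suc i))" "Suc i < m" by blast
    then show "p \<in> {(Inr i, Inr (Suc i)) | i. 1 \<le> i \<and> Suc i < m} \<union> {Inr 0} \<times> (Inr ` {1..<m} \<inter> {Inr 1})"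
      by (cases "i = 0") auto
  qed auto
  then show ?thesis using order_edges_chain_above[of T n VD] assms by auto
qed

text \<open>
  If the root is an ascent vertex, then it serves as the centre: all its children are descents and so
  come after it. If the root is a descent vertex, then the bottom vertex of the chain has to come
  before it and serves as the centre. In both cases \<open>A\<close> consists of the centre and \<open>H\<close> further
  vertices below it, nothing in \<open>A\<close> has to precede the centre, and the rest of the chain is
  attached to the centre. In the second case with an empty chain the root of the extended tree would
  have to be a descent, which is impossible; correspondingly the formula gives the number of
  extensions with the centre in the last position, which is \<open>0\<close>.
\<close>

lemma num_descent_labelings_formula:
  fixes T :: "'a rtree"
  assumes T: "rooted_tree T" and VD: "VD \<subseteq> verts T"
    and root: "tree_root T \<in> VD \<or> children T (tree_root T) \<subseteq> VD"
  obtains A :: "('a + nat) set" and EA c H where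
    "oriented_tree A EA c" "card A = Suc H" "\<And>v. (v, c) \<notin> EA" "H \<le> card (verts T)"
    "\<And>n. card (verts T) \<le> n \<Longrightarrow> real (num_descent_labelings T VD n) =
       (\<Sum>k\<le>H. (partial_sum ^^ k) (\<lambda>i. real (rank_count A EA c i)) H * real ((n - H) choose k))"
proof -
  define s where "s = card (verts T)"
  have fin: "finite (verts T)" and rt: "tree_root T \<in> verts T" using T by (auto simp: rooted_tree_def)
  have s: "0 < s" using fin rt by (auto simp: s_def card_gt_0_iff)
  have par: "parent T v \<in> verts T" if "v \<in> verts T - {tree_root T}" for v
    using rooted_tree_parent[OF T] that by auto
  show thesis
  proof (cases "tree_root T \<in> VD")
    case True
    define A :: "('a + nat) set" where "A = {Inr 0} \<union> Inl ` verts T"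
    define EA where "EA = {(Inr 0, Inl (tree_root T))} \<union> tree_edges T VD (verts T)"
    have "oriented_tree ({Inr 0} \<union> {Inl (tree_root T)}) ({} \<union> {} \<union> {(Inr 0, Inl (tree_root T))}) (Inr 0 :: 'a + nat)"
      by (intro oriented_tree.glue_after oriented_tree.single) auto
    then have ot: "oriented_tree A EA (Inr 0)"
      unfolding A_def EA_def using rt par by (intro oriented_tree_grow T) auto
    have cA: "card A = Suc s"
      using fin by (subst A_def, subst card_Un_disjoint) (auto simp: card_image s_def)
    (* The centre is never last because the root of the tree comes after it. *)
    have last: "rank_count A EA (Inr 0) s = 0"
    proof -
      have False if LR: "L @ Inr 0 # R \<in> linexts A EA" "length L = s" for L R
      proof -
        have "R = []" using length_linexts[OF LR(1)] LR(2) cA by auto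
        then have "Inl (tree_root T) \<in> set L" using LR(1) rt by (auto simp: linexts_def A_def)
        then show False using LR(1) by (auto simp: linexts_def EA_def sorted_wrt_append)
      qed
      then have "{(L, R). L @ Inr 0 # R \<in> linexts A EA \<and> length L = s} = {}" by blast
      then show ?thesis unfolding rank_count_def by (simp only: card.empty)
    qed
    show thesis
    proof (rule that[OF ot cA])
      show "(v, Inr 0) \<notin> EA" for v by (auto simp: EA_def tree_edges_def)
      show "s \<le> card (verts T)" by (simp add: s_def)
      fix n assume n: "card (verts T) \<le> n"
      show "real (num_descent_labelings T VD n) =
          (\<Sum>k\<le>s. (partial_sum ^^ k) (\<lambda>i. real (rank_count A EA (Inr 0) i)) s * real ((n - s) choose k))"
      proof (cases "n = s")
        case True
        (* The chain is empty, and the root of a tree is never a descent. *)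
        have "Inl (tree_root T) \<notin> Des (chain_above T n) w" for w
          by (auto simp: Des_def chain_above_def True s_def)
        then have "descent_labelings T VD n = {}"
          using \<open>tree_root T \<in> VD\<close> by (auto simp: descent_labelings_def)
        moreover have "(\<Sum>k\<le>s. (partial_sum ^^ k) (\<lambda>i. real (rank_count A EA (Inr 0) i)) s * real (0 choose k)) = 0"
          using last by (subst sum.atMost_shift) simp
        ultimately show ?thesis by (simp add: num_descent_labelings_def True)
      next
        case False
        then have m: "0 < n - s" using n by (simp add: s_def)
        have "verts (chain_above T n) = A \<union> Inr ` {1..<n - s}"
          using m by (auto simp: chain_above_def Let_def A_def s_def image_iff) 
        moreover have "order_edges (chain_above T n) (Inl ` VD) =
            EA \<union> chain_edges 1 (n - s) \<union> {Inr 0} \<times> (Inr ` {1..<n - s} \<inter> {Inr 1})"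
          using order_edges_root_descent[of T VD n] rt True m by (auto simp: EA_def s_def)
        moreover have "Inl ` VD \<subseteq> verts (chain_above T n) - {tree_root (chain_above T n)}"
          using VD m by (auto simp: chain_above_def Let_def s_def)
        ultimately have "num_descent_labelings T VD n = card (linexts (A \<union> Inr ` {1..<n - s})
            (EA \<union> chain_edges 1 (n - s) \<union> {Inr 0} \<times> (Inr ` {1..<n - s} \<inter> {Inr 1})))"
          by (simp add: num_descent_labelings_linexts[OF T])
        also have "\<dots> = (\<Sum>i\<le>s. rank_count A EA (Inr 0) i * ((s + (n - s - 1) - i) choose (s - i)))"
          using oriented_tree_wf[OF ot] cA by (intro card_linexts_chain_glue) (auto simp: A_def)
        also have "\<dots> = (\<Sum>i\<le>s. rank_count A EA (Inr 0) i * ((n - s + s - 1 - i) choose (s - i)))"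
          using m by simp
        finally show ?thesis using newton_value[of "n - s" "rank_count A EA (Inr 0)" s] m by simp
      qed
    qed
  next
    case False
    define A :: "('a + nat) set" where "A = {} \<union> Inl ` verts T"
    define EA where "EA = {} \<union> tree_edges T VD (verts T)"
    define c :: "'a + nat" where "c = Inl (tree_root T)"
    define H where "H = s - 1"
    have H: "s = Suc H" using s by (simp add: H_def)
    have ot: "oriented_tree A EA c"
      unfolding A_def EA_def c_def using rt par oriented_tree.single[of "Inl (tree_root T)"]
      by (intro oriented_tree_grow T) auto
    have cA: "card A = Suc H" by (simp add: A_def card_image s_def[symmetric] H)
    show thesis
    proof (rule that[OF ot cA])
      show "(v, c) \<notin> EA" for v
        using root False rooted_tree_parent[OF T]
        by (auto simp: EA_def tree_edges_def c_def children_def)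
      show "H \<le> card (verts T)" using H by (simp add: s_def)
      fix n assume n: "card (verts T) \<le> n"
      have "verts (chain_above T n) = A \<union> Inr ` {0..<n - s}"
        by (auto simp: chain_above_def Let_def A_def s_def)
      moreover have "order_edges (chain_above T n) (Inl ` VD) =
          EA \<union> chain_edges 0 (n - s) \<union> {c} \<times> (Inr ` {0..<n - s} \<inter> {Inr 0})"
        using order_edges_root_ascent[of T VD n] rt False n by (simp add: EA_def s_def c_def)
      moreover have "Inl ` VD \<subseteq> verts (chain_above T n) - {tree_root (chain_above T n)}"
        using VD False by (auto simp: chain_above_def Let_def s_def)
      ultimately have "num_descent_labelings T VD n = card (linexts (A \<union> Inr ` {0..<n - s})
          (EA \<union> chain_edges 0 (n - s) \<union> {c} \<times> (Inr ` {0..<n - s} \<inter> {Inr 0})))"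
        by (simp add: num_descent_labelings_linexts[OF T])
      also have "\<dots> = (\<Sum>i\<le>H. rank_count A EA c i * ((H + (n - s - 0) - i) choose (H - i)))"
        using oriented_tree_wf[OF ot] cA by (intro card_linexts_chain_glue) (auto simp: A_def)
      also have "\<dots> = (\<Sum>i\<le>H. rank_count A EA c i * ((n - H + H - 1 - i) choose (H - i)))"
        using n H by (intro sum.cong refl) (simp add: s_def[symmetric])
      finally show "real (num_descent_labelings T VD n) =
          (\<Sum>k\<le>H. (partial_sum ^^ k) (\<lambda>i. real (rank_count A EA c i)) H * real ((n - H) choose k))"
        using newton_value[of "n - H" "rank_count A EA c" H] n H by (simp add: s_def[symmetric])
    qed
  qed
qed

section \<open>Log-concavity of the coefficients\<close>

theorem theorem3p7:
  fixes T :: "'a rtree" and VD :: "'a set" and h :: nat and a :: "nat \<Rightarrow> real"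
  assumes "rooted_tree T"
    and "VD \<subseteq> verts T"
    and "tree_root T \<in> VD \<or> children T (tree_root T) \<subseteq> VD"
    and "h = degree (descent_poly T VD)"
    and "\<forall>x::real. poly (descent_poly T VD) x = (\<Sum>k=0..h. a k * ((x - real h) gchoose k))"
  shows "(\<forall>k\<le>h. a k \<in> \<nat>) \<and> log_concave h a"
proof -
  obtain A :: "('a + nat) set" and EA c H where
    ot: "oriented_tree A EA c" and card: "card A = Suc H" and first: "\<And>v. (v, c) \<notin> EA"
    and H: "H \<le> card (verts T)"
    and count: "\<And>n. card (verts T) \<le> n \<Longrightarrow> real (num_descent_labelings T VD n) =
       (\<Sum>k\<le>H. (partial_sum ^^ k) (\<lambda>i. real (rank_count A EA c i)) H * real ((n - H) choose k))"
    by (rule num_descent_labelings_formula[OF assms(1-3)]) blast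
  define R where "R = (\<lambda>i. real (rank_count A EA c i))"
  define b where "b k = (partial_sum ^^ k) R H" for k
  have agree: "poly (newton_poly H b) (real n) = real (num_descent_labelings T VD n)"
    if "card (verts T) \<le> n" for n
  proof -
    have "real n - real H = real (n - H)" using that H by simp
    then show ?thesis
      by (simp only: poly_newton_poly count[OF that] b_def R_def binomial_gbinomial)
  qed
  have poly: "descent_poly T VD = newton_poly H b"
    unfolding descent_poly_def
  proof (rule the_equality)
    fix P assume "\<forall>n\<ge>card (verts T). poly P (real n) = real (num_descent_labelings T VD n)"
    then show "P = newton_poly H b"
      using agree by (intro poly_eq_if_agree_eventually[of "card (verts T)"]) simp
  qed (use agree in blast)
  have "b H = R 0" unfolding b_def by (rule funpow_partial_sum_top)
  moreover have "0 < R 0"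
    using rank_count_first_pos[OF oriented_tree_linexts_nonempty[OF ot] oriented_tree_wf(1,2)[OF ot] first]
    by (simp add: R_def)
  (* The top coefficient is positive, so the degree is exactly H. *)
  ultimately have h: "h = H" using degree_newton_poly[of b H] assms(4) poly by simp
  have ab: "a k = b k" if "k \<le> h" for k
  proof (rule newton_coeffs_unique[OF _ that])
    fix x :: real
    show "(\<Sum>k\<le>h. a k * ((x - real h) gchoose k)) = (\<Sum>k\<le>h. b k * ((x - real h) gchoose k))"
      using assms(5) poly_newton_poly[of H b x] poly h by (simp add: atLeast0AtMost)
  qed
  have "lc_limit H R"
    using oriented_tree_rank_count_lc[OF ot] card by (simp add: R_def)
  then have "log_concave H b"
    unfolding b_def by (intro funpow_partial_sum_log_concave lc_limit_imp_pf2)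
  then have "log_concave h a"
    unfolding log_concave_def
  proof (intro allI impI)
    fix k assume "0 < k \<and> k < h"
    then have "a (k - 1) = b (k - 1)" "a k = b k" "a (k + 1) = b (k + 1)" "0 < k" "k < H"
      using h by (auto intro!: ab)
    then show "a (k - 1) * a (k + 1) \<le> (a k)\<^sup>2"
      using \<open>log_concave H b\<close> by (simp add: log_concave_def)
  qed
  moreover have "a k \<in> \<nat>" if "k \<le> h" for k
    using ab[OF that] funpow_partial_sum_Nats by (simp add: b_def R_def)
  ultimately show ?thesis by blast
qed

end
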